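(* Let $m,n\ge1$ be integers. The number of realizable Catalan states for the $m\times n$ lattice crossing is $$\left|\mathfrak{Cat}_{m,n}^{R}\right|=\frac{1}{m+n+1}\binom{2(m+n)}{m+n}-T^h(m,n)-T^h(n,m).$$ In particular, for $m=n$, $$\left|\mathfrak{Cat}_{n,n}^{R}\right|=\frac{1}{2n+1}\binom{4n}{2n}-2\left(\binom{4n}{n-2}-2\binom{4n}{n-3}+\binom{4n}{n-4}\right).$$
   Context: For integers $m,n\ge1$, $P$ is a rectangle with $2(m+n)$ marked boundary points: $n$ on the top side and $n$ on the bottom side (positions $1,\dots,n$ from left to right), and $m$ on the left side and $m$ on the right side (positions $1,\dots,m$ from top to bottom). A Catalan state is a crossingless connection of the marked points by $m+n$ disjoint arcs in $P$, up to isotopy fixing the boundary (denoted $\approx$); equivalently a noncrossing perfect matching of the marked points. $\mathfrak{Cat}_{m,n}$ is the set of Catalan states. The lattice crossing $L(m,n)$ is the tangle diagram in $P$ consisting of $m$ horizontal segments (left position $i$ to right position $i$) and $n$ vertical segments (top position $j$ to bottom position $j$), with $mn$ crossings. A Kauffman state $s$ of $L(m,n)$ is a choice of a positive or negative marker at every crossing; the crossing is smoothed accordingly in one of two ways: one marker joins its top end with its right end and its left end with its bottom end, the other joins its top end with its left end and its right end with its bottom end. $K(s)$ is the diagram obtained by smoothing all crossings according to $s$ and deleting all closed components. $C\in\mathfrak{Cat}_{m,n}$ is realizable if $K(s)\approx C$ for some Kauffman state $s$ of $L(m,n)$; $\mathfrak{Cat}^R_{m,n}$ is the set of realizable Catalan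 states. For $1\le i\le m-1$, $l_i^h$ is the horizontal line crossing $P$ between positions $i$ and $i+1$ on both the left and right sides; $\#(l_i^h\cap C)$ is the number of arcs of $C$ whose endpoints lie on different sides of $l_i^h$ (the minimal number of intersections). $d^h(C)=\max\{\#(l_i^h\cap C):1\le i\le m-1\}$ (equal to $0$ if $m=1$), and $T^h(m,n)=|\{C\in\mathfrak{Cat}_{m,n}: d^h(C)>n\}|$ (so $T^h(n,m)$ is the analogous number for $\mathfrak{Cat}_{n,m}$, counting states with $d^h(C)>m$). Convention: $\binom{y}{z}=0$ when $z<0$. *)

theory Defs
  imports Complex_Main
begin

text \<open>Positions are numbered from left to right (top, bottom) and from top to bottom (left, right).\<close>

datatype point = Top nat | Bottom nat | Left nat | Right nat

definition marked_points :: "nat \<Rightarrow> nat \<Rightarrow> point set" where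
  "marked_points m n = Top ` {1..n} \<union> Bottom ` {1..n} \<union> Left ` {1..m} \<union> Right ` {1..m}"

text \<open>Rank of a marked point when the boundary is traversed clockwise from the top left corner.\<close>

fun boundary_rank :: "nat \<Rightarrow> nat \<Rightarrow> point \<Rightarrow> nat" where
  "boundary_rank m n (Top j) = j"
| "boundary_rank m n (Right i) = n + i"
| "boundary_rank m n (Bottom j) = n + m + (n + 1 - j)"
| "boundary_rank m n (Left i) = n + m + n + (m + 1 - i)"

definition perfect_matching :: "'a set \<Rightarrow> 'a set set \<Rightarrow> bool" where
  "perfect_matching V C \<longleftrightarrow>
     (\<forall>e\<in>C. e \<subseteq> V \<and> card e = 2) \<and> (\<forall>p\<in>V. \<exists>!e. e \<in> C \<and> p \<in> e)"

definition noncrossing :: "nat \<Rightarrow> nat \<Rightarrow> point set set \<Rightarrow> bool" where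
  "noncrossing m n C \<longleftrightarrow>
     \<not> (\<exists>a b c d. {a, c} \<in> C \<and> {b, d} \<in> C \<and>
          boundary_rank m n a < boundary_rank m n b \<and>
          boundary_rank m n b < boundary_rank m n c \<and>
          boundary_rank m n c < boundary_rank m n d)"

text \<open>An isotopy class of crossingless connections is represented by the matching of its
  endpoints, so the relation \<open>\<approx>\<close> on connections becomes equality of matchings.\<close>

definition catalan_states :: "nat \<Rightarrow> nat \<Rightarrow> point set set set" where
  "catalan_states m n = {C. perfect_matching (marked_points m n) C \<and> noncrossing m n C}"

text \<open>The crossings cut the lattice crossing \<open>L(m,n)\<close> into edges. For \<open>0 \<le> j \<le> n\<close>, \<open>HEdge i j\<close> is
  the edge of the \<open>i\<close>-th horizontal segment between columns \<open>j\<close> and \<open>j + 1\<close>; for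
  \<open>0 \<le> i \<le> m\<close>, \<open>VEdge i j\<close> is the edge of the \<open>j\<close>-th vertical segment between rows \<open>i\<close> and
  \<open>i + 1\<close>. Here columns \<open>0\<close>, \<open>n + 1\<close> and rows \<open>0\<close>, \<open>m + 1\<close> are the sides of the
  rectangle. Thus the top, right, bottom and left ends at the crossing \<open>(i, j)\<close> are
  \<open>VEdge (i - 1) j\<close>, \<open>HEdge i j\<close>, \<open>VEdge i j\<close> and \<open>HEdge i (j - 1)\<close>.\<close>

datatype edge = HEdge nat nat | VEdge nat nat

fun end_edge :: "nat \<Rightarrow> nat \<Rightarrow> point \<Rightarrow> edge" where
  "end_edge m n (Top j) = VEdge 0 j"
| "end_edge m n (Bottom j) = VEdge m j"
| "end_edge m n (Left i) = HEdge i 0"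
| "end_edge m n (Right i) = HEdge i n"

datatype marker = Positive | Negative

text \<open>A Kauffman state assigns a marker to each crossing \<open>(i, j)\<close> with \<open>1 \<le> i \<le> m\<close> and
  \<open>1 \<le> j \<le> n\<close>; its values elsewhere are ignored. Which of the two smoothings is called
  positive is immaterial for the set of realizable states.\<close>

type_synonym kauffman_state = "nat \<times> nat \<Rightarrow> marker"

inductive smoothing :: "nat \<Rightarrow> nat \<Rightarrow> kauffman_state \<Rightarrow> edge \<Rightarrow> edge \<Rightarrow> bool"
  for m n :: nat and s :: kauffman_state where
  top_right: "\<lbrakk>i \<in> {1..m}; j \<in> {1..n}; s (i, j) = Positive\<rbrakk>
     \<Longrightarrow> smoothing m n s (VEdge (i - 1) j) (HEdge i j)"
| left_bottom: "\<lbrakk>i \<in> {1..m}; j \<in> {1..n}; s (i, j) = Positive\<rbrakk>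
     \<Longrightarrow> smoothing m n s (HEdge i (j - 1)) (VEdge i j)"
| top_left: "\<lbrakk>i \<in> {1..m}; j \<in> {1..n}; s (i, j) = Negative\<rbrakk>
     \<Longrightarrow> smoothing m n s (VEdge (i - 1) j) (HEdge i (j - 1))"
| right_bottom: "\<lbrakk>i \<in> {1..m}; j \<in> {1..n}; s (i, j) = Negative\<rbrakk>
     \<Longrightarrow> smoothing m n s (HEdge i j) (VEdge i j)"

text \<open>The components of the smoothed diagram are the classes of edges under \<open>equivclp\<close>. Closed
  components contain no marked point, so they contribute nothing to the matching below.\<close>

definition smoothed_diagram :: "nat \<Rightarrow> nat \<Rightarrow> kauffman_state \<Rightarrow> point set set" where
  "smoothed_diagram m n s =
     {{p, q} | p q. p \<in> marked_points m n \<and> q \<in> marked_points m n \<and> p \<noteq> q \<and>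
        equivclp (smoothing m n s) (end_edge m n p) (end_edge m n q)}"

definition realizable_states :: "nat \<Rightarrow> nat \<Rightarrow> point set set set" where
  "realizable_states m n = {C \<in> catalan_states m n. \<exists>s. smoothed_diagram m n s = C}"

text \<open>The side of the line \<open>l\<^sub>i\<^sup>h\<close> between positions \<open>i\<close> and \<open>i + 1\<close>.\<close>

fun above_line :: "nat \<Rightarrow> point \<Rightarrow> bool" where
  "above_line i (Top j) \<longleftrightarrow> True"
| "above_line i (Bottom j) \<longleftrightarrow> False"
| "above_line i (Left k) \<longleftrightarrow> k \<le> i"
| "above_line i (Right k) \<longleftrightarrow> k \<le> i"

definition line_intersections :: "nat \<Rightarrow> point set set \<Rightarrow> nat" where
  "line_intersections i C = card {e \<in> C. (\<exists>p\<in>e. above_line i p) \<and> (\<exists>q\<in>e. \<not> above_line i q)}"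

definition d_h :: "nat \<Rightarrow> point set set \<Rightarrow> nat" where
  "d_h m C = (if m = 1 then 0 else Max ((\<lambda>i. line_intersections i C) ` {1..m - 1}))"

definition T_h :: "nat \<Rightarrow> nat \<Rightarrow> nat" where
  "T_h m n = card {C \<in> catalan_states m n. d_h m C > n}"

definition binom :: "nat \<Rightarrow> int \<Rightarrow> nat" where
  "binom y z = (if z < 0 then 0 else y choose nat z)"

end

(* Cut the disc along the arcs of a Catalan state C: its regions form a plane tree whose edges are the
   arcs. Sending every boundary cell of the rectangle to its region is 1-Lipschitz for the grid
   distance exactly when every line l_i^h meets C at most n times and every vertical line at most m
   times, since the numbers of intersections are the tree distances. A tree is an injective metric
   space, so under these conditions the map extends to all cells. Around a crossing the extension
   is a closed walk of length four in a tree, so two opposite cells have the same image, and smoothing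
   the crossing so as to merge these cells gives a Kauffman state in which the strands follow the arcs.
   The conditions are necessary because an arc crosses the line l_i^h only in one of n edges, and no
   state violates both kinds of conditions, by the four point condition of the tree.

   To count the states that violate a horizontal condition, record the numbers of intersections while
   the points are added from the bottom of the rectangle to the top. This is a bijection from Catalan
   states to Dyck paths, and a condition is violated iff the path exceeds the height n + 1. Such paths are
   counted by repeated reflection. *)

theory Submission
  imports Defs "HOL-Library.Disjoint_Sets"
begin

text \<open>The dual tree is never built. Cell \<open>g\<close> of the boundary lies between the
  ranks \<open>g\<close> and \<open>g + 1\<close>, and the tree distance of the cells
  \<open>a\<close> and \<open>b\<close> is the number of arcs with exactly one end in
  \<open>{a<..b}\<close>. Metric statements thus become inequalities between cut sizes, most of them
  checked arc by arc. The tree is recovered from the heights above the region at the top left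
  corner, that is, from a Dyck path. Two obstacles shape the rest. A smoothed diagram is only an
  equivalence closure on edges, so strands are not followed; instead every edge carries the pair of
  vertices on its two sides, which smoothing preserves. This pair tells which marked points can be
  joined, and a parity count shows that every marked point is joined to another one. Moreover, from
  one line to the next two points are added, at both ends of an interval of ranks, while a walk
  takes one step per point. The parity of the cut sizes closes this gap and is the origin of
  \<open>n + 1\<close> in place of \<open>n\<close>.\<close>

section \<open>Perfect matchings and the number of arcs leaving a set of points\<close>

definition cut_size :: "'a set \<Rightarrow> 'a set set \<Rightarrow> nat" where
  "cut_size A D = card {e \<in> D. e \<inter> A \<noteq> {} \<and> \<not> e \<subseteq> A}"

lemma perfect_matching_partner:
  assumes "perfect_matching V D" "p \<in> V"
  obtains q where "q \<in> V" "q \<noteq> p" "{p, q} \<in> D" "\<And>e. e \<in> D \<Longrightarrow> p \<in> e \<Longrightarrow> e = {p, q}"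
proof -
  have "\<exists>!e. e \<in> D \<and> p \<in> e"
    using assms unfolding perfect_matching_def by blast
  then obtain e where e: "e \<in> D" "p \<in> e" "\<And>f. f \<in> D \<Longrightarrow> p \<in> f \<Longrightarrow> f = e"
    by blast
  have "e \<subseteq> V" "card e = 2"
    using assms(1) e(1) unfolding perfect_matching_def by auto
  obtain x y where "e = {x, y}" "x \<noteq> y"
    using \<open>card e = 2\<close> by (metis card_2_iff)
  then obtain q where q: "e = {p, q}" "q \<noteq> p"
    using e(2) by blast
  show ?thesis
  proof (rule that)
    show "q \<in> V" "q \<noteq> p" "{p, q} \<in> D" using q e(1) \<open>e \<subseteq> V\<close> by auto
    show "f = {p, q}" if "f \<in> D" "p \<in> f" for f using e(3)[OF that] q(1) by simp
  qed
qed

lemma perfect_matching_unique: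
  assumes "perfect_matching V D" "{p, q} \<in> D" "{p, q'} \<in> D"
  shows "q = q'"
proof -
  have "p \<in> V" using assms unfolding perfect_matching_def by auto
  then have "{p, q} = {p, q'}"
    using perfect_matching_partner[OF assms(1)] assms(2,3) by (metis insertI1)
  then show ?thesis by (metis doubleton_eq_iff)
qed

lemma perfect_matching_arc:
  assumes "perfect_matching V D" "e \<in> D"
  obtains x y where "e = {x, y}" "x \<noteq> y" "x \<in> V" "y \<in> V"
  using assms unfolding perfect_matching_def by (metis card_2_iff insert_subset)

lemma perfect_matching_finite: "perfect_matching V D \<Longrightarrow> finite V \<Longrightarrow> finite D"
  unfolding perfect_matching_def by (meson PowI finite_Pow_iff finite_subset subsetI)

lemma cut_eq_sum:
  assumes "finite D"
  shows "cut_size A D = (\<Sum>e\<in>D. of_bool (e \<inter> A \<noteq> {} \<and> \<not> e \<subseteq> A))"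
proof -
  have "{e \<in> D. e \<inter> A \<noteq> {} \<and> \<not> e \<subseteq> A} = D \<inter> {e. e \<inter> A \<noteq> {} \<and> \<not> e \<subseteq> A}"
    by blast
  then show ?thesis using assms by (simp only: cut_size_def sum_of_bool_eq of_nat_id)
qed

lemma cut_cong:
  assumes "perfect_matching V D"
    and "\<And>x y. {x, y} \<in> D \<Longrightarrow> x \<in> V \<Longrightarrow> y \<in> V \<Longrightarrow> (x \<in> A \<longleftrightarrow> y \<in> A) \<longleftrightarrow> (x \<in> B \<longleftrightarrow> y \<in> B)"
  shows "cut_size A D = cut_size B D"
proof -
  have "(e \<inter> A \<noteq> {} \<and> \<not> e \<subseteq> A) \<longleftrightarrow> (e \<inter> B \<noteq> {} \<and> \<not> e \<subseteq> B)" if e: "e \<in> D" for e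
  proof -
    obtain x y where "e = {x, y}" "x \<in> V" "y \<in> V"
      using perfect_matching_arc[OF assms(1) e] by metis
    then show ?thesis using assms(2)[of x y] e by auto
  qed
  then show ?thesis unfolding cut_size_def by (intro arg_cong[where f = card]) blast
qed

lemma cut_complement:
  assumes "perfect_matching V D"
  shows "cut_size (V - A) D = cut_size A D"
  by (rule cut_cong[OF assms]) auto

text \<open>Only the arc at \<open>x\<close> changes its status: it stops being cut if its other end
  is already in \<open>A\<close>, and begins to be cut otherwise.\<close>

lemma cut_insert_cases:
  assumes pm: "perfect_matching V D" and fin: "finite V" and x: "x \<in> V" "x \<notin> A"
    and y: "{x, y} \<in> D"
  shows "if y \<in> A then cut_size A D = cut_size (insert x A) D + 1 else cut_size (insert x A) D = cut_size A D + 1"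
proof -
  let ?P = "\<lambda>A e. e \<inter> A \<noteq> {} \<and> \<not> e \<subseteq> A"
  have finD: "finite D" using perfect_matching_finite[OF pm fin] .
  obtain q where q: "q \<noteq> x" "{x, q} \<in> D" "\<And>e. e \<in> D \<Longrightarrow> x \<in> e \<Longrightarrow> e = {x, q}"
    using perfect_matching_partner[OF pm x(1)] by metis
  have yq: "y = q" using perfect_matching_unique[OF pm y q(2)] .
  have other: "?P (insert x A) e = ?P A e" if "e \<in> D - {{x, y}}" for e
  proof -
    have "x \<notin> e" using q(3) that yq by blast
    then show ?thesis by blast
  qed
  have split: "cut_size B D = of_bool (?P B {x, y}) + (\<Sum>e\<in>D - {{x, y}}. of_bool (?P B e))" for B
    unfolding cut_eq_sum[OF finD] by (rule sum.remove[OF finD y])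
  have "(\<Sum>e\<in>D - {{x, y}}. of_bool (?P (insert x A) e)) = (\<Sum>e\<in>D - {{x, y}}. of_bool (?P A e) :: nat)"
    by (rule sum.cong[OF refl]) (simp only: other)
  then show ?thesis unfolding split using x q(1) yq by simp
qed

lemma cut_insert:
  assumes "perfect_matching V D" "finite V" "x \<in> V" "x \<notin> A"
  shows "cut_size (insert x A) D = cut_size A D + 1 \<or> cut_size A D = cut_size (insert x A) D + 1"
proof -
  obtain y where "{x, y} \<in> D" using perfect_matching_partner[OF assms(1,3)] by metis
  from cut_insert_cases[OF assms this] show ?thesis by (auto split: if_splits)
qed

lemma cut_empty [simp]: "cut_size {} D = 0"
  by (simp add: cut_size_def)

lemma cut_le_card_and_parity:
  assumes "perfect_matching V D" "finite V" "A \<subseteq> V"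
  shows "cut_size A D \<le> card A \<and> (even (cut_size A D) \<longleftrightarrow> even (card A))"
proof -
  have "finite A" using assms finite_subset by auto
  then show ?thesis using assms(3)
  proof (induction A)
    case empty then show ?case by simp
  next
    case (insert x A)
    have "cut_size (insert x A) D = cut_size A D + 1 \<or> cut_size A D = cut_size (insert x A) D + 1"
      using cut_insert[OF assms(1,2)] insert by auto
    then show ?case using insert by auto
  qed
qed

section \<open>Noncrossing matchings and Dyck paths\<close>

text \<open>Symmetric in \<open>a\<close> and \<open>c\<close>, so that the two ends of an arc,
  which is an unordered pair, can be named in either order.\<close>

definition between :: "nat \<Rightarrow> nat \<Rightarrow> nat \<Rightarrow> bool" where
  "between a b c \<longleftrightarrow> a < b \<and> b < c \<or> c < b \<and> b < a"

definition noncrossing_matchings :: "nat set \<Rightarrow> nat set set set" where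
  "noncrossing_matchings V = {D. perfect_matching V D \<and>
     \<not> (\<exists>a b c d. {a, c} \<in> D \<and> {b, d} \<in> D \<and> a < b \<and> b < c \<and> c < d)}"

text \<open>Partial noncrossing matchings: the \<open>k\<close> unmatched points carry open strands
  that lead to the outside, so no arc may pass over them.\<close>

definition open_matchings :: "nat set \<Rightarrow> nat \<Rightarrow> nat set set set" where
  "open_matchings I k = {D. (\<forall>e\<in>D. e \<subseteq> I \<and> card e = 2) \<and> disjoint D \<and>
     (\<forall>a b c d. {a, c} \<in> D \<longrightarrow> {b, d} \<in> D \<longrightarrow> between a b c \<longrightarrow> between a d c) \<and>
     (\<forall>a b c. {a, c} \<in> D \<longrightarrow> b \<in> I - \<Union>D \<longrightarrow> \<not> between a b c) \<and>
     card (I - \<Union>D) = k}"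

text \<open>An open strand counts as cut because its other end is yet to be read. When it is closed
  later, an unmatched point of \<open>A\<close> turns into a cut arc and the value for
  \<open>A\<close> stays the same.\<close>

definition open_cut :: "nat set \<Rightarrow> nat set set \<Rightarrow> nat" where
  "open_cut A D = cut_size A D + card (A - \<Union>D)"

lemma open_matchingsD:
  assumes "D \<in> open_matchings I k"
  shows "\<And>e. e \<in> D \<Longrightarrow> e \<subseteq> I" "\<And>e. e \<in> D \<Longrightarrow> card e = 2" "disjoint D"
    "\<And>a b c d. {a, c} \<in> D \<Longrightarrow> {b, d} \<in> D \<Longrightarrow> between a b c \<Longrightarrow> between a d c"
    "\<And>a b c. {a, c} \<in> D \<Longrightarrow> b \<in> I \<Longrightarrow> b \<notin> \<Union>D \<Longrightarrow> \<not> between a b c"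
    "card (I - \<Union>D) = k"
  using assms unfolding open_matchings_def mem_Collect_eq by blast+

lemma open_matchingsI:
  assumes "\<And>e. e \<in> D \<Longrightarrow> e \<subseteq> I" "\<And>e. e \<in> D \<Longrightarrow> card e = 2" "disjoint D"
    "\<And>a b c d. {a, c} \<in> D \<Longrightarrow> {b, d} \<in> D \<Longrightarrow> between a b c \<Longrightarrow> between a d c"
    "\<And>a b c. {a, c} \<in> D \<Longrightarrow> b \<in> I \<Longrightarrow> b \<notin> \<Union>D \<Longrightarrow> \<not> between a b c"
    "card (I - \<Union>D) = k"
  shows "D \<in> open_matchings I k"
  unfolding open_matchings_def mem_Collect_eq
proof (intro conjI ballI allI impI)
  show "between a d c" if "{a, c} \<in> D" "{b, d} \<in> D" "between a b c" for a b c d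
    by (rule assms(4)[OF that])
  show "\<not> between a b c" if "{a, c} \<in> D" "b \<in> I - \<Union>D" for a b c
    by (rule assms(5)) (use that in auto)
qed (fact assms)+

lemma noncrossing_matchingsD:
  assumes "D \<in> noncrossing_matchings V"
  shows "perfect_matching V D"
    "\<And>a b c d. {a, c} \<in> D \<Longrightarrow> {b, d} \<in> D \<Longrightarrow> a < b \<Longrightarrow> b < c \<Longrightarrow> c < d \<Longrightarrow> False"
  using assms unfolding noncrossing_matchings_def mem_Collect_eq by blast+

lemma perfect_matching_disjoint:
  assumes "perfect_matching V D"
  shows "disjoint D"
proof (rule disjointI)
  fix e f assume e: "e \<in> D" and f: "f \<in> D" and "e \<noteq> f"
  show "e \<inter> f = {}"
  proof (rule ccontr)
    assume "e \<inter> f \<noteq> {}"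
    then obtain p where p: "p \<in> e" "p \<in> f" by blast
    then have "p \<in> V" using assms e unfolding perfect_matching_def by blast
    then show False using perfect_matching_partner[OF assms] e f p \<open>e \<noteq> f\<close> by metis
  qed
qed

lemma open_matchings_0:
  assumes "finite V"
  shows "open_matchings V 0 = noncrossing_matchings V"
proof (intro set_eqI iffI)
  fix D assume D: "D \<in> open_matchings V 0"
  have cover: "V \<subseteq> \<Union>D" using open_matchingsD(6)[OF D] assms by auto
  have "\<exists>!e. e \<in> D \<and> p \<in> e" if "p \<in> V" for p
    using open_matchingsD(3)[OF D] that cover unfolding disjoint_def by blast
  then have "perfect_matching V D"
    using open_matchingsD(1,2)[OF D] unfolding perfect_matching_def by simp
  moreover have False if "{a, c} \<in> D" "{b, d} \<in> D" "a < b" "b < c" "c < d" for a b c d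
    using open_matchingsD(4)[OF D that(1,2)] that(3-5) by (simp add: between_def)
  ultimately show "D \<in> noncrossing_matchings V"
    unfolding noncrossing_matchings_def mem_Collect_eq by blast
next
  fix D assume D: "D \<in> noncrossing_matchings V"
  note pm = noncrossing_matchingsD(1)[OF D] and nc = noncrossing_matchingsD(2)[OF D]
  have arc: "e \<subseteq> V" "card e = 2" if "e \<in> D" for e
    using pm that unfolding perfect_matching_def by blast+
  show "D \<in> open_matchings V 0"
  proof (rule open_matchingsI)
    show "between a d c" if ac: "{a, c} \<in> D" and bd: "{b, d} \<in> D" and b: "between a b c" for a b c d
    proof -
      have ca: "{c, a} \<in> D" and db: "{d, b} \<in> D" using ac bd by (simp_all add: insert_commute)
      have "d \<noteq> a" using perfect_matching_unique[OF pm ac] db b by (auto simp: between_def)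
      moreover have "d \<noteq> c" using perfect_matching_unique[OF pm ca] db b by (auto simp: between_def)
      moreover have "\<not> (a < b \<and> b < c \<and> c < d)" using nc[OF ac bd] by blast
      moreover have "\<not> (d < a \<and> a < b \<and> b < c)" using nc[OF db ac] by blast
      moreover have "\<not> (c < b \<and> b < a \<and> a < d)" using nc[OF ca bd] by blast
      moreover have "\<not> (d < c \<and> c < b \<and> b < a)" using nc[OF db ca] by blast
      ultimately show ?thesis using b unfolding between_def by linarith
    qed
    have empty: "V - \<Union>D = {}" using pm unfolding perfect_matching_def by blast
    show "card (V - \<Union>D) = 0" unfolding empty by simp
    show "\<not> between a b c" if "b \<in> V" "b \<notin> \<Union>D" for a b c
      using empty that by blast
  qed (use arc perfect_matching_disjoint[OF pm] in auto)
qed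

lemma finite_open_matchings: "finite I \<Longrightarrow> finite (open_matchings I k)"
  by (rule finite_subset[of _ "Pow (Pow I)"]) (auto dest: open_matchingsD(1))

text \<open>The order in which the points of the rectangle will be read alternates between its left
  and right sides, so a new point may extend the interval at either end; both cases are treated at
  once.\<close>

definition extreme :: "nat set \<Rightarrow> nat \<Rightarrow> bool" where
  "extreme I x \<longleftrightarrow> (\<forall>a\<in>I. a < x) \<or> (\<forall>a\<in>I. x < a)"

lemma extreme_not_mem: "extreme I x \<Longrightarrow> x \<notin> I"
  by (auto simp: extreme_def)

lemma extreme_not_between: "extreme I x \<Longrightarrow> a \<in> I \<Longrightarrow> c \<in> I \<Longrightarrow> \<not> between a x c"
  unfolding extreme_def between_def by (meson less_asym)

lemma open_matchings_insert_open:
  assumes fin: "finite I" and ext: "extreme I x"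
  shows "{D \<in> open_matchings (insert x I) k. x \<notin> \<Union>D} =
    (if k = 0 then {} else open_matchings I (k - 1))"
proof -
  have x: "x \<notin> I" using ext by (rule extreme_not_mem)
  have card: "card (insert x I - \<Union>D) = Suc (card (I - \<Union>D))" if "x \<notin> \<Union>D" for D
    using that x fin by (simp add: insert_Diff_if del: Union_iff)
  have 1: "k \<noteq> 0 \<and> D \<in> open_matchings I (k - 1)"
    if D: "D \<in> open_matchings (insert x I) k" and xD: "x \<notin> \<Union>D" for D
  proof
    show "k \<noteq> 0" using open_matchingsD(6)[OF D] card[OF xD] by simp
    show "D \<in> open_matchings I (k - 1)"
    proof (rule open_matchingsI)
      show "e \<subseteq> I" if "e \<in> D" for e
        using open_matchingsD(1)[OF D that] that xD by blast
      show "card (I - \<Union>D) = k - 1" using open_matchingsD(6)[OF D] card[OF xD] by simp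
      show "\<not> between a b c" if "{a, c} \<in> D" "b \<in> I" "b \<notin> \<Union>D" for a b c
        by (rule open_matchingsD(5)[OF D]) (use that in auto)
    qed (fact open_matchingsD[OF D])+
  qed
  have 2: "D \<in> open_matchings (insert x I) k \<and> x \<notin> \<Union>D"
    if D: "D \<in> open_matchings I (k - 1)" and k: "k \<noteq> 0" for D
  proof
    show xD: "x \<notin> \<Union>D" using open_matchingsD(1)[OF D] x by blast
    show "D \<in> open_matchings (insert x I) k"
    proof (rule open_matchingsI)
      show "e \<subseteq> insert x I" if "e \<in> D" for e
        using open_matchingsD(1)[OF D that] by blast
      show "card (insert x I - \<Union>D) = k" using open_matchingsD(6)[OF D] card[OF xD] k by simp
      show "\<not> between a b c" if ac: "{a, c} \<in> D" and b: "b \<in> insert x I" "b \<notin> \<Union>D" for a b c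
      proof (cases "b = x")
        case True
        then show ?thesis using extreme_not_between[OF ext] open_matchingsD(1)[OF D ac] by simp
      next
        case False
        show ?thesis by (rule open_matchingsD(5)[OF D ac]) (use False b in auto)
      qed
    qed (fact open_matchingsD[OF D])+
  qed
  show ?thesis using 1 2 by auto
qed

definition nearest :: "nat set \<Rightarrow> nat \<Rightarrow> nat \<Rightarrow> bool" where
  "nearest J x y \<longleftrightarrow> y \<in> J \<and> (\<forall>z\<in>J. \<not> between x z y)"

lemma extreme_subset: "extreme I x \<Longrightarrow> J \<subseteq> I \<Longrightarrow> extreme J x"
  by (auto simp: extreme_def)

lemma extreme_finite_nearest:
  assumes "finite J" "J \<noteq> {}" "extreme J x"
  shows "nearest J x (SOME y. nearest J x y)"
proof -
  have "\<exists>y. nearest J x y"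
  proof (cases "\<forall>a\<in>J. a < x")
    case True
    then have "nearest J x (Max J)" using assms by (auto simp: nearest_def between_def leD)
    then show ?thesis by blast
  next
    case False
    then have "nearest J x (Min J)"
      using assms by (auto simp: nearest_def between_def extreme_def leD)
    then show ?thesis by blast
  qed
  then show ?thesis by (rule someI_ex)
qed

lemma nearest_unique:
  assumes "extreme J x" "nearest J x y" "nearest J x y'"
  shows "y = y'"
proof -
  have "y \<in> J" "y' \<in> J" "\<not> between x y y'" "\<not> between x y' y"
    using assms(2,3) unfolding nearest_def by blast+
  then show ?thesis using assms(1) unfolding extreme_def between_def
    by (metis linorder_neqE_nat)
qed

text \<open>Reading the extreme point \<open>x\<close> either opens a new strand or closes the nearest open one.\<close>

lemma close_arc:
  assumes fin: "finite I" and ext: "extreme I x"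
    and D: "D \<in> open_matchings (insert x I) k" and xy: "{x, y} \<in> D"
  shows "D - {{x, y}} \<in> open_matchings I (k + 1)" "nearest (I - \<Union>(D - {{x, y}})) x y"
    "I - \<Union>(D - {{x, y}}) = insert y (I - \<Union>D)" "y \<in> I" "y \<notin> \<Union>(D - {{x, y}})"
proof -
  let ?D = "D - {{x, y}}"
  have x: "x \<notin> I" using ext by (rule extreme_not_mem)
  have "card {x, y} = 2" "{x, y} \<subseteq> insert x I" using open_matchingsD(1,2)[OF D xy] by auto
  then have yx: "y \<noteq> x" and yI: "y \<in> I" by auto
  have other: "x \<notin> e \<and> y \<notin> e" if e: "e \<in> ?D" for e
  proof -
    have "e \<inter> {x, y} = {}" by (rule disjointD[OF open_matchingsD(3)[OF D] _ xy]) (use e in auto)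
    then show ?thesis by auto
  qed
  show yD: "y \<notin> \<Union>?D" using other by blast
  have U: "\<Union>D = insert x (insert y (\<Union>?D))" using xy by auto
  show op: "I - \<Union>?D = insert y (I - \<Union>D)" using U x yI yD yx by blast
  have opx: "insert x I - \<Union>D = I - \<Union>D" using xy by auto
  show "?D \<in> open_matchings I (k + 1)"
  proof (rule open_matchingsI)
    show "e \<subseteq> I" if "e \<in> ?D" for e
      using open_matchingsD(1)[OF D, of e] that other[OF that] by auto
    show "card e = 2" if "e \<in> ?D" for e
      using open_matchingsD(2)[OF D, of e] that by auto
    show "disjoint ?D" by (rule pairwise_subset[OF open_matchingsD(3)[OF D]]) auto
    show "between a d c" if "{a, c} \<in> ?D" "{b, d} \<in> ?D" "between a b c" for a b c d
      by (rule open_matchingsD(4)[OF D _ _ that(3)]) (use that in auto)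
    show "card (I - \<Union>?D) = k + 1"
      unfolding op using open_matchingsD(6)[OF D] fin U yI by (simp add: opx)
    show "\<not> between a b c" if ac: "{a, c} \<in> ?D" and b: "b \<in> I" "b \<notin> \<Union>?D" for a b c
    proof (cases "b = y")
      case True
      have sub: "{a, c} \<subseteq> I" using open_matchingsD(1)[OF D, of "{a, c}"] ac other[OF ac] by auto
      \<comment> \<open>An old arc over the freed point \<open>y\<close> would have to pass over its
        partner \<open>x\<close> as well, which is impossible for an extreme point.\<close>
      have "{y, x} \<in> D" using xy by (simp add: insert_commute)
      then have "between a y c \<Longrightarrow> between a x c"
        using open_matchingsD(4)[OF D, of a c y x] ac by auto
      then show ?thesis using extreme_not_between[OF ext] sub True by auto
    next
      case False
      have "b \<notin> \<Union>D" using False b x unfolding U by blast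
      then show ?thesis using open_matchingsD(5)[OF D, of a c b] ac b by auto
    qed
  qed
  show "nearest (I - \<Union>?D) x y"
    unfolding nearest_def op
  proof (intro conjI ballI)
    fix z assume "z \<in> insert y (I - \<Union>D)"
    then show "\<not> between x z y"
      using open_matchingsD(5)[OF D xy, of z] by (auto simp: between_def)
  qed (use op in blast)
  show "y \<in> I" by (rule yI)
qed

lemma disjoint_insertI: "disjoint D \<Longrightarrow> (\<And>e. e \<in> D \<Longrightarrow> a \<inter> e = {}) \<Longrightarrow> disjoint (insert a D)"
  by (simp add: pairwise_insert disjnt_def Int_commute)

text \<open>The inverse of \<open>close_arc\<close>. The new arc passes over no open point because
  \<open>y\<close> is nearest, and no old arc passes over its ends: \<open>x\<close> is extreme and
  \<open>y\<close> was open.\<close>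

lemma open_arc:
  assumes fin: "finite I" and ext: "extreme I x"
    and D: "D \<in> open_matchings I (k + 1)" and y: "nearest (I - \<Union>D) x y"
  shows "insert {x, y} D \<in> open_matchings (insert x I) k" "{x, y} \<notin> D"
proof -
  let ?D = "insert {x, y} D"
  have x: "x \<notin> I" using ext by (rule extreme_not_mem)
  have xD: "x \<notin> \<Union>D" using open_matchingsD(1)[OF D] x by blast
  have yI: "y \<in> I" "y \<notin> \<Union>D" using y unfolding nearest_def by auto
  then have yx: "y \<noteq> x" using x by auto
  show "{x, y} \<notin> D" using xD by blast
  have op: "insert x I - \<Union>?D = (I - \<Union>D) - {y}" using x by auto
  have nb: "\<not> between x b y" if "b \<in> I" "b \<notin> \<Union>D" for b
    using y that unfolding nearest_def by blast
  have nxy: "\<not> between a x c" "\<not> between a y c" if ac: "{a, c} \<in> D" for a c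
    using open_matchingsD(1)[OF D ac] extreme_not_between[OF ext, of a c]
      open_matchingsD(5)[OF D ac yI] by auto
  show "?D \<in> open_matchings (insert x I) k"
  proof (rule open_matchingsI)
    show "e \<subseteq> insert x I" if "e \<in> ?D" for e
      using open_matchingsD(1)[OF D, of e] that yI by auto
    show "card e = 2" if "e \<in> ?D" for e
      using open_matchingsD(2)[OF D, of e] that yx by auto
    show "disjoint ?D"
    proof (rule disjoint_insertI)
      show "{x, y} \<inter> e = {}" if "e \<in> D" for e using that xD yI by blast
    qed (rule open_matchingsD(3)[OF D])
    show "card (insert x I - \<Union>?D) = k"
      unfolding op using open_matchingsD(6)[OF D] fin yI by (simp)
    show "\<not> between a b c" if ac: "{a, c} \<in> ?D" and b: "b \<in> insert x I" "b \<notin> \<Union>?D" for a b c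
    proof -
      have bI: "b \<in> I" "b \<notin> \<Union>D" using b by auto
      show ?thesis
      proof (cases "{a, c} \<in> D")
        case True
        then show ?thesis using open_matchingsD(5)[OF D True bI] by simp
      next
        case False
        then have "{a, c} = {x, y}" using ac by blast
        then show ?thesis using nb[OF bI] by (auto simp: doubleton_eq_iff between_def)
      qed
    qed
    show "between a d c" if ac: "{a, c} \<in> ?D" and bd: "{b, d} \<in> ?D" and b: "between a b c" for a b c d
    proof (cases "{a, c} \<in> D")
      case True
      then show ?thesis
      proof (cases "{b, d} \<in> D")
        case True
        show ?thesis by (rule open_matchingsD(4)[OF D \<open>{a, c} \<in> D\<close> True b])
      next
        case False
        then have "{b, d} = {x, y}" using bd by blast
        then show ?thesis using nxy[OF True] b by (auto simp: doubleton_eq_iff)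
      qed
    next
      case False
      then have eq: "{a, c} = {x, y}" using ac by blast
      then have bxy: "between x b y" using b by (auto simp: doubleton_eq_iff between_def)
      then have "{b, d} \<in> D" using bd by (auto simp: doubleton_eq_iff between_def)
      then have bdI: "b \<in> I" "d \<in> I" "\<not> between b x d" "\<not> between b y d" "b \<noteq> y" "d \<noteq> y"
        using open_matchingsD(1)[OF D] nxy yI by auto
      \<comment> \<open>Since \<open>y\<close> does not lie between \<open>b\<close> and
        \<open>d\<close>, both are on the same side of \<open>y\<close>, namely the side facing the
        extreme point \<open>x\<close>.\<close>
      then have "between x d y"
        using bxy ext yI unfolding between_def extreme_def by (metis linorder_neqE_nat less_asym)
      then show ?thesis using eq by (auto simp: doubleton_eq_iff between_def)
    qed
  qed
qed

lemma open_cut_self: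
  assumes D: "D \<in> open_matchings I k"
  shows "open_cut I D = k"
proof -
  have "{e \<in> D. e \<inter> I \<noteq> {} \<and> \<not> e \<subseteq> I} = {}" using open_matchingsD(1)[OF D] by auto
  then have "cut_size I D = 0" unfolding cut_size_def by (simp only: card.empty)
  then show ?thesis using open_matchingsD(6)[OF D] by (simp add: open_cut_def)
qed

lemma open_cut_insert_arc:
  assumes "finite D" "finite A" "x \<notin> A" "y \<noteq> x" "y \<notin> \<Union>D" "x \<notin> \<Union>D"
  shows "open_cut A (insert {x, y} D) = open_cut A D"
proof -
  let ?C = "\<lambda>D. {e \<in> D. e \<inter> A \<noteq> {} \<and> \<not> e \<subseteq> A}"
  have new: "{x, y} \<notin> D" using assms by blast
  show ?thesis
  proof (cases "y \<in> A")
    case True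
    have "?C (insert {x, y} D) = insert {x, y} (?C D)" using True assms(3) by auto
    then have "card (?C (insert {x, y} D)) = Suc (card (?C D))" using new assms(1) by simp
    moreover have "A - \<Union>D = insert y (A - \<Union>(insert {x, y} D))" using True assms by auto
    moreover have "card (insert y (A - \<Union>(insert {x, y} D))) = Suc (card (A - \<Union>(insert {x, y} D)))"
      by (rule card_insert_disjoint) (use assms(2) in auto)
    ultimately show ?thesis by (simp only: open_cut_def cut_size_def add_Suc add_Suc_right)
  next
    case False
    have "?C (insert {x, y} D) = ?C D" using False assms(3) by auto
    moreover have "A - \<Union>(insert {x, y} D) = A - \<Union>D" using False assms(3) by auto
    ultimately show ?thesis by (simp only: open_cut_def cut_size_def)
  qed
qed

definition bounded_matchings :: "nat \<Rightarrow> (nat \<Rightarrow> nat) \<Rightarrow> nat \<Rightarrow> nat \<Rightarrow> nat set set set" where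
  "bounded_matchings H x t k =
     {D \<in> open_matchings (x ` {..<t}) k. \<forall>s\<le>t. open_cut (x ` {..<s}) D \<le> H}"

lemma finite_bounded_matchings: "finite (bounded_matchings H x t k)"
  unfolding bounded_matchings_def using finite_open_matchings[of "x ` {..<t}" k] by simp

text \<open>The recursion of walks between the heights \<open>0\<close> and \<open>H\<close>. If the
  last point is unmatched, deleting it leaves \<open>k - 1\<close> open strands; if it is matched,
  deleting its arc frees the partner and leaves \<open>k + 1\<close>. Earlier open cuts are
  unaffected, and the open cut of the whole set is \<open>k\<close> itself.\<close>

lemma bounded_matchings_Suc:
  assumes ext: "extreme (x ` {..<t}) (x t)"
  shows "card (bounded_matchings H x (Suc t) k) =
    (if k \<le> H then (if k = 0 then 0 else card (bounded_matchings H x t (k - 1)))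
       + card (bounded_matchings H x t (k + 1)) else 0)"
proof (cases "k \<le> H")
  case False
  have "bounded_matchings H x (Suc t) k = {}"
    using False open_cut_self[of _ "x ` {..<Suc t}" k] unfolding bounded_matchings_def by fastforce
  then show ?thesis using False by simp
next
  case True
  let ?I = "x ` {..<t}"
  let ?B = "bounded_matchings H x (Suc t) k"
  have fin: "finite ?I" by simp
  have I: "x ` {..<Suc t} = insert (x t) ?I" by (simp add: lessThan_Suc)
  have xt: "x t \<notin> ?I" using ext by (rule extreme_not_mem)
  have xs: "x t \<notin> x ` {..<s}" if "s \<le> t" for s using xt that by force
  have B: "D \<in> ?B \<longleftrightarrow> D \<in> open_matchings (insert (x t) ?I) k \<and> (\<forall>s\<le>t. open_cut (x ` {..<s}) D \<le> H)" for D
    using True open_cut_self[of D "x ` {..<Suc t}" k]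
    by (auto simp: bounded_matchings_def le_Suc_eq I)
  have opened: "{D \<in> ?B. x t \<notin> \<Union>D} = (if k = 0 then {} else bounded_matchings H x t (k - 1))"
    (is "?L = ?R")
  proof -
    have "?L = {D \<in> {D \<in> open_matchings (insert (x t) ?I) k. x t \<notin> \<Union>D}.
        \<forall>s\<le>t. open_cut (x ` {..<s}) D \<le> H}"
      using B by blast
    also have "\<dots> = ?R"
      unfolding open_matchings_insert_open[OF fin ext] by (auto simp: bounded_matchings_def)
    finally show ?thesis .
  qed
  let ?f = "\<lambda>D. insert {x t, SOME y. nearest (?I - \<Union>D) (x t) y} D"
  have finD: "finite D" if "D \<in> open_matchings ?I j" for D j
    using open_matchingsD(1)[OF that] fin by (meson PowI finite_Pow_iff finite_subset subsetI)
  have near: "nearest (?I - \<Union>D) (x t) (SOME y. nearest (?I - \<Union>D) (x t) y)"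
    if "D \<in> open_matchings ?I (k + 1)" for D
  proof (rule extreme_finite_nearest)
    show "?I - \<Union>D \<noteq> {}" using open_matchingsD(6)[OF that] by (metis add_is_0 card.empty one_neq_zero)
  qed (auto intro: extreme_subset[OF ext])
  have cuts: "open_cut (x ` {..<s}) (insert {x t, y} D) = open_cut (x ` {..<s}) D"
    if "D \<in> open_matchings ?I j" "y \<in> ?I" "y \<notin> \<Union>D" "s \<le> t" for D j y s
  proof (rule open_cut_insert_arc)
    show "x t \<notin> \<Union>D" using open_matchingsD(1)[OF that(1)] xt by blast
    show "y \<noteq> x t" using that(2) xt by blast
  qed (use that xs finD in auto)
  have "bij_betw ?f (bounded_matchings H x t (k + 1)) {D \<in> ?B. x t \<in> \<Union>D}"
  proof (rule bij_betwI')
    fix D1 D2 assume D: "D1 \<in> bounded_matchings H x t (k + 1)" "D2 \<in> bounded_matchings H x t (k + 1)"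
    have rec: "{e \<in> ?f D. x t \<notin> e} = D" if "D \<in> bounded_matchings H x t (k + 1)" for D
      using that open_matchingsD(1)[of D ?I "k + 1"] xt unfolding bounded_matchings_def by blast
    show "(?f D1 = ?f D2) = (D1 = D2)" using rec[OF D(1)] rec[OF D(2)] by auto
  next
    fix D assume D: "D \<in> bounded_matchings H x t (k + 1)"
    then have D': "D \<in> open_matchings ?I (k + 1)" by (simp add: bounded_matchings_def)
    let ?y = "SOME y. nearest (?I - \<Union>D) (x t) y"
    note y = near[OF D']
    then have "?y \<in> ?I - \<Union>D" unfolding nearest_def by blast
    then have y2: "?y \<in> ?I" "?y \<notin> \<Union>D" by blast+
    show "?f D \<in> {D \<in> ?B. x t \<in> \<Union>D}"
      unfolding mem_Collect_eq B
      using open_arc(1)[OF fin ext D' y] cuts[OF D' y2] D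
      by (auto simp: bounded_matchings_def)
  next
    fix D assume "D \<in> {D \<in> ?B. x t \<in> \<Union>D}"
    then have D: "D \<in> ?B" and "x t \<in> \<Union>D" by simp_all
    then obtain e where e: "e \<in> D" "x t \<in> e" by blast
    have D': "D \<in> open_matchings (insert (x t) ?I) k" using D B by blast
    obtain a b where "e = {a, b}" using open_matchingsD(2)[OF D' e(1)] by (meson card_2_iff)
    then obtain y where xy: "{x t, y} \<in> D" using e by (metis insertE insert_commute singletonD)
    let ?D = "D - {{x t, y}}"
    note c = close_arc[OF fin ext D' xy]
    have "(SOME y. nearest (?I - \<Union>?D) (x t) y) = y"
      using nearest_unique[OF _ near c(2)] c(1) extreme_subset[OF ext] by blast
    then have "?f ?D = D" using xy by auto
    moreover have "?D \<in> bounded_matchings H x t (k + 1)"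
    proof -
      have "insert {x t, y} ?D = D" using xy by auto
      then show ?thesis using c(1) cuts[OF c(1,4,5)] D B unfolding bounded_matchings_def by auto
    qed
    ultimately show "\<exists>D'\<in>bounded_matchings H x t (k + 1). D = ?f D'" by (metis (lifting))
  qed
  then have closed: "card {D \<in> ?B. x t \<in> \<Union>D} = card (bounded_matchings H x t (k + 1))"
    by (simp add: bij_betw_same_card)
  have "card ?B = card ({D \<in> ?B. x t \<notin> \<Union>D} \<union> {D \<in> ?B. x t \<in> \<Union>D})"
    by (rule arg_cong[where f = card]) blast
  also have "card ({D \<in> ?B. x t \<notin> \<Union>D} \<union> {D \<in> ?B. x t \<in> \<Union>D}) =
      card {D \<in> ?B. x t \<notin> \<Union>D} + card {D \<in> ?B. x t \<in> \<Union>D}"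
  proof (rule card_Un_disjoint)
    show "finite {D \<in> ?B. x t \<notin> \<Union>D}" "finite {D \<in> ?B. x t \<in> \<Union>D}"
      by (rule finite_subset[OF _ finite_bounded_matchings[of H x "Suc t" k]]; blast)+
  qed blast
  finally show ?thesis unfolding closed opened using True by simp
qed

section \<open>Walks in a strip\<close>

fun strip_walks :: "nat \<Rightarrow> nat \<Rightarrow> nat \<Rightarrow> nat" where
  "strip_walks H 0 k = (if k = 0 then 1 else 0)"
| "strip_walks H (Suc t) k = (if k \<le> H
     then (if k = 0 then 0 else strip_walks H t (k - 1)) + strip_walks H t (k + 1) else 0)"

lemma card_bounded_matchings:
  assumes "\<And>s. s < t \<Longrightarrow> extreme (x ` {..<s}) (x s)"
  shows "card (bounded_matchings H x t k) = strip_walks H t k"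
  using assms
proof (induction t arbitrary: k)
  case 0
  have "D \<in> open_matchings {} k \<longleftrightarrow> D = {} \<and> k = 0" for D
  proof
    assume D: "D \<in> open_matchings {} k"
    have "e \<notin> D" for e using open_matchingsD(1,2)[OF D, of e] by auto
    then show "D = {} \<and> k = 0" using open_matchingsD(6)[OF D] by auto
  next
    assume "D = {} \<and> k = 0"
    then show "D \<in> open_matchings {} k" by (auto intro: open_matchingsI)
  qed
  then have "bounded_matchings H x 0 k = (if k = 0 then {{}} else {})"
    by (auto simp: bounded_matchings_def open_cut_def)
  then show ?case by simp
next
  case (Suc t)
  then show ?case by (simp add: bounded_matchings_Suc)
qed

lemma card_noncrossing_matchings_bounded:
  assumes ext: "\<And>s. s < t \<Longrightarrow> extreme (x ` {..<s}) (x s)"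
  shows "card {D \<in> noncrossing_matchings (x ` {..<t}). \<forall>s\<le>t. cut_size (x ` {..<s}) D \<le> H} = strip_walks H t 0"
proof -
  have "open_cut (x ` {..<s}) D = cut_size (x ` {..<s}) D"
    if D: "D \<in> noncrossing_matchings (x ` {..<t})" and s: "s \<le> t" for D s
  proof -
    have "x ` {..<t} \<subseteq> \<Union>D"
      using noncrossing_matchingsD(1)[OF D] unfolding perfect_matching_def by blast
    moreover have "x ` {..<s} \<subseteq> x ` {..<t}" using s by auto
    ultimately have "x ` {..<s} - \<Union>D = {}" by blast
    then show ?thesis unfolding open_cut_def by (simp only: card.empty)
  qed
  then have "{D \<in> noncrossing_matchings (x ` {..<t}). \<forall>s\<le>t. cut_size (x ` {..<s}) D \<le> H} = bounded_matchings H x t 0"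
    unfolding bounded_matchings_def open_matchings_0[OF finite_imageI[OF finite_lessThan]] by auto
  then show ?thesis using card_bounded_matchings[OF ext] by simp
qed

text \<open>Reflection principle: \<open>periodic_walks\<close> starts from the charges \<open>1\<close> at \<open>0\<close> and \<open>- 1\<close> at \<open>- 2\<close>,
  repeated with period \<open>2 * (H + 2)\<close>, so it is antisymmetric about both \<open>- 1\<close> and \<open>H + 1\<close>.\<close>

fun periodic_walks :: "nat \<Rightarrow> nat \<Rightarrow> int \<Rightarrow> int" where
  "periodic_walks H 0 y = of_bool (2 * (int H + 2) dvd y) - of_bool (2 * (int H + 2) dvd (y + 2))"
| "periodic_walks H (Suc t) y = periodic_walks H t (y - 1) + periodic_walks H t (y + 1)"

lemma periodic_walks_reflect: "periodic_walks H t (-2 - y) = - periodic_walks H t y"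
proof (induction t arbitrary: y)
  case 0
  have "2 * (int H + 2) dvd - 2 - y \<longleftrightarrow> 2 * (int H + 2) dvd y + 2"
    using dvd_minus_iff[of "2 * (int H + 2)" "y + 2"] by (simp add: algebra_simps minus_diff_commute)
  then show ?case by simp
next
  case (Suc t)
  show ?case using Suc[of "y + 1"] Suc[of "y - 1"] by (simp add: algebra_simps)
qed

lemma periodic_walks_periodic: "periodic_walks H t (y + 2 * (int H + 2)) = periodic_walks H t y"
proof (induction t arbitrary: y)
  case 0
  have "2 * (int H + 2) dvd z + 2 * (int H + 2) \<longleftrightarrow> 2 * (int H + 2) dvd z" for z
    by (rule dvd_add_triv_right_iff)
  from this[of y] this[of "y + 2"] show ?case by (simp add: algebra_simps)
next
  case (Suc t)
  show ?case using Suc[of "y + 1"] Suc[of "y - 1"] by (simp add: algebra_simps)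
qed

text \<open>Each barrier is fixed by a reflection that reverses the sign: \<open>- 1\<close> by the
  reflection itself, \<open>H + 1\<close> by the reflection followed by one period.\<close>

lemma periodic_walks_barriers:
  "periodic_walks H t (-1) = 0" "periodic_walks H t (int H + 1) = 0"
proof -
  show "periodic_walks H t (-1) = 0" using periodic_walks_reflect[of H t "-1"] by simp
  have "-2 - (int H + 1) + 2 * (int H + 2) = int H + 1" by simp
  then show "periodic_walks H t (int H + 1) = 0"
    using periodic_walks_reflect[of H t "int H + 1"] periodic_walks_periodic[of H t "-2 - (int H + 1)"]
    by simp
qed

text \<open>The range includes the barrier \<open>H + 1\<close>, where both sides vanish, so that
  the induction hypothesis applies to the upper neighbour of \<open>k = H\<close>.\<close>

lemma strip_walks_eq_periodic_walks:
  "k \<le> H + 1 \<Longrightarrow> int (strip_walks H t k) = periodic_walks H t (int k)"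
proof (induction t arbitrary: k)
  case 0
  have "\<not> 2 * (int H + 2) dvd int k + 2"
    using 0 zdvd_imp_le[of "2 * (int H + 2)" "int k + 2"] by auto
  moreover have "2 * (int H + 2) dvd int k \<longleftrightarrow> k = 0"
    using 0 zdvd_imp_le[of "2 * (int H + 2)" "int k"] by auto
  ultimately show ?case by simp
next
  case (Suc t)
  consider "k = 0" | "k = H + 1" | "0 < k" "k \<le> H" using Suc.prems by linarith
  then show ?case
  proof cases
    case 1
    then show ?thesis using Suc.IH[of 1] periodic_walks_barriers(1)[of H t] by simp
  next
    case 2
    then show ?thesis using periodic_walks_barriers(2)[of H "Suc t"] by (simp add: add.commute)
  next
    case 3
    then show ?thesis using Suc.IH[of "k - 1"] Suc.IH[of "k + 1"]
      by (simp add: of_nat_diff add.commute)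
  qed
qed

section \<open>Binomial sums for the numbers of walks\<close>

lemma sum_binomial_Suc:
  fixes a :: "nat \<Rightarrow> int"
  shows "(\<Sum>j\<le>Suc t. int (Suc t choose j) * a j) =
    (\<Sum>j\<le>t. int (t choose j) * a j) + (\<Sum>j\<le>t. int (t choose j) * a (Suc j))"
proof -
  have "(\<Sum>j\<le>t. int (t choose j) * a j) = (\<Sum>j\<le>Suc t. int (t choose j) * a j)" by simp
  also have "\<dots> = a 0 + (\<Sum>j\<le>t. int (t choose Suc j) * a (Suc j))"
    by (subst sum.atMost_Suc_shift) simp
  finally show ?thesis
    by (subst sum.atMost_Suc_shift) (simp add: algebra_simps sum.distrib)
qed

lemma periodic_walks_closed_form:
  "periodic_walks H t y = (\<Sum>j\<le>t. int (t choose j) * periodic_walks H 0 (y - int t + 2 * int j))"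
proof (induction t arbitrary: y)
  case 0 then show ?case by simp
next
  case (Suc t)
  have "y - 1 - int t + 2 * int j = y - int (Suc t) + 2 * int j"
    "y + 1 - int t + 2 * int j = y - int (Suc t) + 2 * int (Suc j)" for j
    by simp_all
  then show ?case
    unfolding sum_binomial_Suc periodic_walks.simps(2) Suc.IH by (simp only:)
qed

text \<open>A walk of length \<open>2 * N\<close> with \<open>j\<close> steps of one kind has
  displacement \<open>2 * (j - N)\<close> up to sign; all displacements are even, so the factor 2 of
  the period cancels.\<close>

lemma strip_walks_closed_form:
  "int (strip_walks H (2 * N) 0) = (\<Sum>j\<le>2 * N. int (2 * N choose j) *
     (of_bool ((int H + 2) dvd (int j - int N)) - of_bool ((int H + 2) dvd (int j - int N + 1))))"
proof -
  have "periodic_walks H 0 (0 - int (2 * N) + 2 * int j) =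
      of_bool ((int H + 2) dvd (int j - int N)) - of_bool ((int H + 2) dvd (int j - int N + 1))" for j
  proof -
    have "0 - int (2 * N) + 2 * int j = 2 * (int j - int N)"
      "0 - int (2 * N) + 2 * int j + 2 = 2 * (int j - int N + 1)" by simp_all
    then show ?thesis unfolding periodic_walks.simps(1) by (simp only: dvd_mult_cancel_left) simp
  qed
  then show ?thesis
    using strip_walks_eq_periodic_walks[of 0 H "2 * N"] periodic_walks_closed_form[of H "2 * N" 0]
    by simp
qed

text \<open>A cut has at most as many arcs as the set has points, so the ceiling
  \<open>2 * N\<close> excludes no matching.\<close>

lemma card_noncrossing_matchings:
  "card (noncrossing_matchings {1..2 * N}) = strip_walks (2 * N) (2 * N) 0"
proof -
  have img: "Suc ` {..<t} = {1..t}" for t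
    by (simp add: lessThan_atLeast0 atLeastLessThanSuc_atLeastAtMost)
  have "cut_size (Suc ` {..<s}) D \<le> 2 * N"
    if "D \<in> noncrossing_matchings (Suc ` {..<2 * N})" "s \<le> 2 * N" for D s
  proof -
    have "cut_size (Suc ` {..<s}) D \<le> card (Suc ` {..<s})"
      by (rule cut_le_card_and_parity[OF noncrossing_matchingsD(1)[OF that(1)], THEN conjunct1])
        (use that(2) in auto)
    then show ?thesis using that(2) by (simp add: card_image)
  qed
  then have "{D \<in> noncrossing_matchings (Suc ` {..<2 * N}). \<forall>s\<le>2 * N. cut_size (Suc ` {..<s}) D \<le> 2 * N}
      = noncrossing_matchings (Suc ` {..<2 * N})"
    by blast
  moreover have "card {D \<in> noncrossing_matchings (Suc ` {..<2 * N}). \<forall>s\<le>2 * N. cut_size (Suc ` {..<s}) D \<le> 2 * N}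
      = strip_walks (2 * N) (2 * N) 0"
    by (rule card_noncrossing_matchings_bounded) (auto simp: extreme_def)
  ultimately show ?thesis unfolding img by simp
qed

lemma sum_choose_of_bool:
  "(\<Sum>j\<le>M. int (M choose j) * of_bool (int j = z)) = int (binom M z)"
proof (cases "0 \<le> z \<and> z \<le> int M")
  case True
  then have "(\<Sum>j\<le>M. int (M choose j) * of_bool (int j = z)) = (\<Sum>j\<le>M. if j = nat z then int (M choose j) else 0)"
    by (intro sum.cong) auto
  then show ?thesis using True by (simp add: binom_def)
next
  case False
  then have "(\<Sum>j\<le>M. int (M choose j) * of_bool (int j = z)) = 0"
    by (intro sum.neutral) auto
  then show ?thesis using False by (auto simp: binom_def)
qed

lemma binom_symmetric: "binom M (int M - z) = binom M z"
proof (cases "0 \<le> z \<and> z \<le> int M")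
  case True
  then have "nat (int M - z) = M - nat z" "nat z \<le> M" by linarith+
  then show ?thesis using True by (simp add: binom_def binomial_symmetric[symmetric])
next
  case False
  then show ?thesis by (auto simp: binom_def)
qed

text \<open>All displacements are smaller than the period, so only the central charge and its mirror
  image contribute.\<close>

lemma strip_walks_large:
  "int (strip_walks (2 * N) (2 * N) 0) = int ((2 * N) choose N) - int (binom (2 * N) (int N - 1))"
proof -
  have small: "q dvd z \<longleftrightarrow> z = 0" if "\<bar>z\<bar> < q" for z q :: int
    using that dvd_imp_le_int[of z q] by auto
  have "of_bool ((int (2 * N) + 2) dvd (int j - int N)) - of_bool ((int (2 * N) + 2) dvd (int j - int N + 1))
      = (of_bool (int j = int N) - of_bool (int j = int N - 1) :: int)" if "j \<le> 2 * N" for j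
    using that small[of "int j - int N" "int (2 * N) + 2"] small[of "int j - int N + 1" "int (2 * N) + 2"]
    by auto
  then have "int (strip_walks (2 * N) (2 * N) 0) =
      (\<Sum>j\<le>2 * N. int (2 * N choose j) * (of_bool (int j = int N) - of_bool (int j = int N - 1)))"
    unfolding strip_walks_closed_form by (intro sum.cong) auto
  also have "\<dots> = int (binom (2 * N) (int N)) - int (binom (2 * N) (int N - 1))"
    by (simp only: right_diff_distrib sum_subtractf sum_choose_of_bool)
  finally show ?thesis by (simp add: binom_def)
qed

lemma catalan_number:
  "real (strip_walks (2 * N) (2 * N) 0) = 1 / real (N + 1) * real ((2 * N) choose N)"
proof (cases N)
  case (Suc k)
  have "Suc k * (2 * N choose Suc k) = (2 * N - k) * (2 * N choose k)"
    by (simp only: binomial_absorption binomial_absorb_comp)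
  then have "N * (2 * N choose N) = (N + 1) * (2 * N choose k)" using Suc by simp
  then have "real N * real (2 * N choose N) = (real N + 1) * real (2 * N choose k)"
    by (metis of_nat_1 of_nat_add of_nat_mult)
  moreover have "real (strip_walks (2 * N) (2 * N) 0) = real (2 * N choose N) - real (2 * N choose k)"
    using arg_cong[OF strip_walks_large[of N], of real_of_int] Suc by (simp add: binom_def)
  ultimately have "(real N + 1) * real (strip_walks (2 * N) (2 * N) 0) =
      (real N + 1) * real (2 * N choose N) - real N * real (2 * N choose N)"
    by (simp only: right_diff_distrib)
  also have "\<dots> = real (2 * N choose N)" by (simp add: algebra_simps)
  finally have "(real N + 1) * real (strip_walks (2 * N) (2 * N) 0) = real (2 * N choose N)" .
  then show ?thesis by (simp add: field_simps)
qed simp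

text \<open>Here \<open>H + 2 = n + 3\<close>, and the shifted indices stay below twice this number
  in absolute value, so only the multiples by \<open>-1\<close>, \<open>0\<close> and
  \<open>1\<close> occur. The symmetry of the binomial coefficients folds \<open>3 * n + 3\<close>
  to \<open>n - 3\<close> and \<open>3 * n + 2\<close> to \<open>n - 2\<close>, which produces the
  coefficient 2 at \<open>n - 3\<close>.\<close>

lemma strip_walks_square:
  fixes n :: nat
  defines "b \<equiv> \<lambda>z. int (binom (4 * n) z)"
  shows "int (strip_walks (n + 1) (4 * n) 0) =
     b (2 * int n) - b (2 * int n - 1) - (b (int n - 2) - 2 * b (int n - 3) + b (int n - 4))"
proof -
  have small: "q dvd z \<longleftrightarrow> z = -q \<or> z = 0 \<or> z = q" if "\<bar>z\<bar> < 2 * q" for z q :: int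
  proof
    assume "q dvd z"
    then obtain k where k: "z = q * k" by (rule dvdE)
    moreover have q: "q > 0" using that by linarith
    ultimately have "q * \<bar>k\<bar> < q * 2" using that by (simp add: abs_mult)
    then have "\<bar>k\<bar> < 2" using q by (simp only: mult_less_cancel_left_pos)
    then have "k = -1 \<or> k = 0 \<or> k = 1" by linarith
    then show "z = -q \<or> z = 0 \<or> z = q" using k by auto
  qed auto
  have 1: "of_bool ((int n + 3) dvd (int j - int (2 * n))) =
      (of_bool (int j = int n - 3) + of_bool (int j = 2 * int n) + of_bool (int j = 3 * int n + 3) :: int)"
    if "j \<le> 4 * n" for j
    using that small[of "int j - int (2 * n)" "int n + 3"] by auto
  have 2: "of_bool ((int n + 3) dvd (int j - int (2 * n) + 1)) =
      (of_bool (int j = int n - 4) + of_bool (int j = 2 * int n - 1) + of_bool (int j = 3 * int n + 2) :: int)"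
    if "j \<le> 4 * n" for j
    using that small[of "int j - int (2 * n) + 1" "int n + 3"] by auto
  have "int (strip_walks (n + 1) (2 * (2 * n)) 0) = (\<Sum>j\<le>4 * n. int (4 * n choose j) *
     (of_bool ((int n + 3) dvd (int j - int (2 * n))) - of_bool ((int n + 3) dvd (int j - int (2 * n) + 1))))"
    unfolding strip_walks_closed_form by (simp add: add.commute)
  also have "\<dots> = (\<Sum>j\<le>4 * n. int (4 * n choose j) *
     (of_bool (int j = int n - 3) + of_bool (int j = 2 * int n) + of_bool (int j = 3 * int n + 3)
      - (of_bool (int j = int n - 4) + of_bool (int j = 2 * int n - 1) + of_bool (int j = 3 * int n + 2))))"
    by (intro sum.cong refl) (simp only: 1 2 atMost_iff)
  also have "\<dots> = b (int n - 3) + b (2 * int n) + b (3 * int n + 3)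
      - (b (int n - 4) + b (2 * int n - 1) + b (3 * int n + 2))"
    by (simp only: b_def right_diff_distrib distrib_left sum_subtractf sum.distrib sum_choose_of_bool)
  also have "b (3 * int n + 3) = b (int n - 3)"
    using binom_symmetric[of "4 * n" "int n - 3"] by (simp add: b_def)
  also have "b (3 * int n + 2) = b (int n - 2)"
    using binom_symmetric[of "4 * n" "int n - 2"] by (simp add: b_def)
  finally show ?thesis by simp
qed

section \<open>The numbers of states violating a line condition\<close>

text \<open>The first \<open>t\<close> points of the order defined below fill the ranks
  \<open>{zigzag_low m n t<..zigzag_high m n t}\<close>. The bottom side extends the upper end, the
  left and right points extend the upper and lower ends in turn, and the top side extends the lower
  end.\<close>

definition zigzag_low :: "nat \<Rightarrow> nat \<Rightarrow> nat \<Rightarrow> nat" where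
  "zigzag_low m n t = (if t \<le> n then n + m else if t \<le> n + 2 * m then n + m - (t - n) div 2
     else 2 * n + 2 * m - t)"

definition zigzag_high :: "nat \<Rightarrow> nat \<Rightarrow> nat \<Rightarrow> nat" where
  "zigzag_high m n t = (if t \<le> n then n + m + t else if t \<le> n + 2 * m then 2 * n + m + (t - n + 1) div 2
     else 2 * n + 2 * m)"

text \<open>The ranks of the bottom points, followed by those of the left and right points
  alternately from bottom to top, followed by those of the top points: every line \<open>l\<^sub>i\<^sup>h\<close> cuts off
  an initial segment of this sequence.\<close>

definition zigzag :: "nat \<Rightarrow> nat \<Rightarrow> nat \<Rightarrow> nat" where
  "zigzag m n t = (if zigzag_high m n (Suc t) = Suc (zigzag_high m n t) then Suc (zigzag_high m n t)
     else zigzag_low m n t)"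

lemma zigzag_step:
  assumes "t < 2 * (m + n)"
  shows "zigzag_high m n (Suc t) = Suc (zigzag_high m n t) \<and> zigzag_low m n (Suc t) = zigzag_low m n t \<or>
    zigzag_high m n (Suc t) = zigzag_high m n t \<and> zigzag_low m n t = Suc (zigzag_low m n (Suc t))"
proof -
  consider "t < n" | s where "t = n + 2 * s" "s < m" | s where "t = n + 2 * s + 1" "s < m" | "t \<ge> n + 2 * m"
  proof -
    assume *: "t < n \<Longrightarrow> thesis" "\<And>s. t = n + 2 * s \<Longrightarrow> s < m \<Longrightarrow> thesis"
      "\<And>s. t = n + 2 * s + 1 \<Longrightarrow> s < m \<Longrightarrow> thesis" "n + 2 * m \<le> t \<Longrightarrow> thesis"
    have "t < n \<or> n + 2 * m \<le> t \<or> t = n + 2 * ((t - n) div 2) \<and> (t - n) div 2 < m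
        \<or> t = n + 2 * ((t - n) div 2) + 1 \<and> (t - n) div 2 < m" by linarith
    then show thesis using * by blast
  qed
  then show ?thesis
  proof cases
    case 4
    then show ?thesis using assms by (auto simp: zigzag_low_def zigzag_high_def)
  qed (auto simp: zigzag_low_def zigzag_high_def)
qed

lemma zigzag_low_le_high: "zigzag_low m n t \<le> zigzag_high m n t"
  by (auto simp: zigzag_low_def zigzag_high_def)

lemma zigzag_image:
  "t \<le> 2 * (m + n) \<Longrightarrow> zigzag m n ` {..<t} = {zigzag_low m n t<..zigzag_high m n t}"
proof (induction t)
  case 0 then show ?case by (simp add: zigzag_low_def zigzag_high_def)
next
  case (Suc t)
  have "zigzag m n ` {..<Suc t} = insert (zigzag m n t) {zigzag_low m n t<..zigzag_high m n t}"
    using Suc by (simp add: lessThan_Suc)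
  also have "\<dots> = {zigzag_low m n (Suc t)<..zigzag_high m n (Suc t)}"
    using zigzag_step[of t m n] zigzag_low_le_high[of m n t] Suc.prems
    unfolding zigzag_def by auto
  finally show ?case .
qed

lemma zigzag_extreme: "t < 2 * (m + n) \<Longrightarrow> extreme (zigzag m n ` {..<t}) (zigzag m n t)"
  unfolding extreme_def using zigzag_image[of t m n] by (auto simp: zigzag_def)

lemma zigzag_image_all: "zigzag m n ` {..<2 * (m + n)} = {1..2 * (m + n)}"
  by (subst zigzag_image) (auto simp: zigzag_low_def zigzag_high_def)

lemma zigzag_image_even:
  assumes "s \<le> m"
  shows "zigzag m n ` {..<n + 2 * s} = {n + m - s<..2 * n + m + s}"
  by (subst zigzag_image) (use assms in \<open>auto simp: zigzag_low_def zigzag_high_def\<close>)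

text \<open>The cut sizes along the zigzag have the parity of the index and change by at most one, so they exceed
  \<open>n + 1\<close> somewhere iff they exceed \<open>n\<close> at one of the lines \<open>l\<^sub>i\<^sup>h\<close>.\<close>

lemma zigzag_cut_exceeds:
  assumes D: "perfect_matching {1..2 * (m + n)} D"
  shows "(\<exists>t\<le>2 * (m + n). n + 1 < cut_size (zigzag m n ` {..<t}) D) \<longleftrightarrow>
    (\<exists>i\<in>{1..m - 1}. n < cut_size {n + i<..2 * n + 2 * m - i} D)"
proof -
  define c where "c t = cut_size (zigzag m n ` {..<t}) D" for t
  let ?V = "{1..2 * (m + n)}"
  have fin: "finite ?V" by simp
  have mem: "zigzag m n t \<in> ?V" if "t < 2 * (m + n)" for t
    using zigzag_image_all[of m n] that by blast
  have sub: "zigzag m n ` {..<t} \<subseteq> ?V" if "t \<le> 2 * (m + n)" for t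
    using mem that by auto
  have step: "c (Suc t) = c t + 1 \<or> c t = c (Suc t) + 1" if "t < 2 * (m + n)" for t
    using cut_insert[OF D fin mem[OF that] extreme_not_mem[OF zigzag_extreme[OF that]]]
    by (simp add: c_def lessThan_Suc)
  have parity: "even (c t) \<longleftrightarrow> even t" if "t \<le> 2 * (m + n)" for t
    using that
  proof (induction t)
    case 0 then show ?case by (simp add: c_def)
  next
    case (Suc t)
    then show ?case using step[of t] by auto
  qed
  have le: "c t \<le> t" if "t \<le> 2 * (m + n)" for t
  proof -
    have "c t \<le> card (zigzag m n ` {..<t})"
      using cut_le_card_and_parity[OF D fin sub[OF that]] by (simp add: c_def)
    also have "\<dots> \<le> t" using card_image_le[of "{..<t}" "zigzag m n"] by simp
    finally show ?thesis .
  qed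
  \<comment> \<open>The points still missing all lie on the top side, so there are at most
    \<open>n\<close> of them.\<close>
  have le': "c t \<le> n" if "n + 2 * m \<le> t" "t \<le> 2 * (m + n)" for t
  proof -
    have "?V - zigzag m n ` {..<t} = {1..2 * n + 2 * m - t}"
      using that by (subst zigzag_image) (auto simp: zigzag_low_def zigzag_high_def)
    then have "c t = cut_size {1..2 * n + 2 * m - t} D"
      using cut_complement[OF D, of "zigzag m n ` {..<t}"] by (simp add: c_def)
    also have "\<dots> \<le> card {1..2 * n + 2 * m - t}"
      by (rule cut_le_card_and_parity[OF D fin, THEN conjunct1]) auto
    finally show ?thesis using that by simp
  qed
  have line: "c (n + 2 * (m - i)) = cut_size {n + i<..2 * n + 2 * m - i} D" if "i \<le> m" for i
    using zigzag_image_even[of "m - i" m n] that by (simp add: c_def algebra_simps)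
  show ?thesis unfolding c_def[symmetric]
  proof
    assume "\<exists>t\<le>2 * (m + n). n + 1 < c t"
    then obtain t where t: "t \<le> 2 * (m + n)" "n + 1 < c t" by blast
    have "n + 1 < t" using le[of t] t by simp
    have "t < n + 2 * m" using le'[of t] t by (cases "n + 2 * m \<le> t") auto
    \<comment> \<open>Rounding \<open>t\<close> down to \<open>n + 2 * s\<close> reaches the index
      of a line; this costs at most one step, hence at most one unit of the cut size.\<close>
    define s where "s = (t - n) div 2"
    have s: "1 \<le> s" "s < m" using \<open>n + 1 < t\<close> \<open>t < n + 2 * m\<close> by (auto simp: s_def)
    have "n < c (n + 2 * s)"
    proof (cases "t = n + 2 * s")
      case True then show ?thesis using t by simp
    next
      case False
      then have "t = Suc (n + 2 * s)" using \<open>n + 1 < t\<close> unfolding s_def by linarith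
      then show ?thesis using step[of "n + 2 * s"] t by auto
    qed
    then have "n < cut_size {n + (m - s)<..2 * n + 2 * m - (m - s)} D"
      using line[of "m - s"] s by simp
    moreover have "m - s \<in> {1..m - 1}" using s by auto
    ultimately show "\<exists>i\<in>{1..m - 1}. n < cut_size {n + i<..2 * n + 2 * m - i} D" by blast
  next
    assume "\<exists>i\<in>{1..m - 1}. n < cut_size {n + i<..2 * n + 2 * m - i} D"
    then obtain i where i: "1 \<le> i" "i \<le> m - 1" "n < cut_size {n + i<..2 * n + 2 * m - i} D" by auto
    let ?t = "n + 2 * (m - i)"
    have "n < c ?t" using line[of i] i by simp
    moreover have "even (c ?t) \<longleftrightarrow> even n" using parity[of ?t] i by auto
    ultimately have "n + 1 < c ?t" by (cases "c ?t = n + 1") auto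
    moreover have "?t \<le> 2 * (m + n)" by simp
    ultimately show "\<exists>t\<le>2 * (m + n). n + 1 < c t" by blast
  qed
qed

lemma card_line_exceeds:
  "card {D \<in> noncrossing_matchings {1..2 * (m + n)}. \<exists>i\<in>{1..m - 1}. n < cut_size {n + i<..2 * n + 2 * m - i} D}
     + strip_walks (n + 1) (2 * (m + n)) 0 = strip_walks (2 * (m + n)) (2 * (m + n)) 0"
proof -
  let ?V = "{1..2 * (m + n)}"
  let ?A = "{D \<in> noncrossing_matchings ?V. \<exists>i\<in>{1..m - 1}. n < cut_size {n + i<..2 * n + 2 * m - i} D}"
  let ?B = "{D \<in> noncrossing_matchings ?V. \<forall>t\<le>2 * (m + n). cut_size (zigzag m n ` {..<t}) D \<le> n + 1}"
  have fin: "finite (noncrossing_matchings ?V)"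
    using finite_open_matchings[of ?V 0] open_matchings_0[of ?V] by simp
  have "D \<in> ?A \<longleftrightarrow> D \<in> noncrossing_matchings ?V - ?B" for D
    using zigzag_cut_exceeds[of m n D, OF noncrossing_matchingsD(1)] by (auto simp: not_le)
  then have "?A \<union> ?B = noncrossing_matchings ?V" "?A \<inter> ?B = {}" by blast+
  then have "card ?A + card ?B = card (noncrossing_matchings ?V)"
    using card_Un_disjoint[of ?A ?B] fin by simp
  moreover have "card ?B = strip_walks (n + 1) (2 * (m + n)) 0"
    using card_noncrossing_matchings_bounded[of "2 * (m + n)" "zigzag m n" "n + 1", OF zigzag_extreme]
    unfolding zigzag_image_all .
  ultimately show ?thesis by (simp only: card_noncrossing_matchings)
qed

section \<open>Catalan states as noncrossing matchings of the boundary ranks\<close>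

lemma perfect_matching_image:
  assumes inj: "inj_on f V" and C: "perfect_matching V C"
  shows "perfect_matching (f ` V) ((`) f ` C)"
  unfolding perfect_matching_def
proof (intro conjI ballI)
  have sub: "e \<subseteq> V" "card e = 2" if "e \<in> C" for e
    using C that unfolding perfect_matching_def by blast+
  fix e' assume "e' \<in> (`) f ` C"
  then obtain e where e: "e \<in> C" "e' = f ` e" by blast
  then show "e' \<subseteq> f ` V" using sub by blast
  show "card e' = 2" using e sub card_image[OF inj_on_subset[OF inj]] by metis
next
  have sub: "e \<subseteq> V" if "e \<in> C" for e
    using C that unfolding perfect_matching_def by blast
  fix p' assume "p' \<in> f ` V"
  then obtain p where p: "p \<in> V" "p' = f p" by blast
  obtain q where q: "{p, q} \<in> C" "\<And>e. e \<in> C \<Longrightarrow> p \<in> e \<Longrightarrow> e = {p, q}"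
    using perfect_matching_partner[OF C p(1)] by metis
  show "\<exists>!e'. e' \<in> (`) f ` C \<and> p' \<in> e'"
  proof (rule ex1I)
    show "f ` {p, q} \<in> (`) f ` C \<and> p' \<in> f ` {p, q}"
    proof
      show "f ` {p, q} \<in> (`) f ` C" by (rule imageI[OF q(1)])
    qed (simp add: p(2))
    fix e' assume e': "e' \<in> (`) f ` C \<and> p' \<in> e'"
    then obtain e where e: "e' = f ` e" "e \<in> C" by (elim conjE imageE)
    then have "f p \<in> f ` e" using e' p(2) by simp
    then have "p \<in> e" using inj_on_image_mem_iff[OF inj p(1) sub[OF e(2)]] by simp
    then show "e' = f ` {p, q}" using q(2)[OF e(2)] e(1) by simp
  qed
qed

lemma image_matching_mem:
  assumes "inj_on f V" "perfect_matching V C" "x \<in> V" "y \<in> V"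
  shows "{f x, f y} \<in> (`) f ` C \<longleftrightarrow> {x, y} \<in> C"
proof -
  have "C \<subseteq> Pow V" using assms(2) unfolding perfect_matching_def by blast
  moreover have "{x, y} \<in> Pow V" using assms(3,4) by simp
  ultimately have "f ` {x, y} \<in> (`) f ` C \<longleftrightarrow> {x, y} \<in> C"
    by (intro inj_on_image_mem_iff[OF inj_on_image_Pow[OF assms(1)]])
  then show ?thesis by simp
qed

lemma image_matching_inverse:
  assumes "\<And>x. x \<in> V \<Longrightarrow> g (f x) = x" "C \<subseteq> Pow V"
  shows "(`) g ` (`) f ` C = C"
proof -
  have "g ` f ` e = e" if "e \<in> C" for e
    using assms that by (force simp: image_image)
  then show ?thesis by (force simp: image_image)
qed

text \<open>\<open>P\<close> describes the complement of \<open>A\<close> because the points below a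
  horizontal line have consecutive ranks, whereas the ranks above it form two pieces around the
  starting corner.\<close>

lemma cut_image:
  assumes inj: "inj_on f V" and C: "perfect_matching V C"
    and P: "\<And>p. p \<in> V \<Longrightarrow> P p \<longleftrightarrow> f p \<notin> A"
  shows "cut_size A ((`) f ` C) = card {e \<in> C. (\<exists>p\<in>e. P p) \<and> (\<exists>q\<in>e. \<not> P q)}"
proof -
  have CV: "e \<subseteq> V" if "e \<in> C" for e using C that unfolding perfect_matching_def by blast
  have iff: "f ` e \<inter> A \<noteq> {} \<and> \<not> f ` e \<subseteq> A \<longleftrightarrow> (\<exists>p\<in>e. P p) \<and> (\<exists>q\<in>e. \<not> P q)" if "e \<in> C" for e
  proof -
    have "P p \<longleftrightarrow> f p \<notin> A" if "p \<in> e" for p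
      by (rule P) (use that CV[OF \<open>e \<in> C\<close>] in blast)
    then show ?thesis by blast
  qed
  have "{e \<in> (`) f ` C. e \<inter> A \<noteq> {} \<and> \<not> e \<subseteq> A} =
      (`) f ` {e \<in> C. f ` e \<inter> A \<noteq> {} \<and> \<not> f ` e \<subseteq> A}"
    by (rule Compr_image_eq)
  also have "{e \<in> C. f ` e \<inter> A \<noteq> {} \<and> \<not> f ` e \<subseteq> A} =
      {e \<in> C. (\<exists>p\<in>e. P p) \<and> (\<exists>q\<in>e. \<not> P q)}"
    by (rule Collect_cong, rule conj_cong[OF refl], rule iff)
  finally have eq: "{e \<in> (`) f ` C. e \<inter> A \<noteq> {} \<and> \<not> e \<subseteq> A} =
      (`) f ` {e \<in> C. (\<exists>p\<in>e. P p) \<and> (\<exists>q\<in>e. \<not> P q)}" .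
  have "inj_on ((`) f) {e \<in> C. (\<exists>p\<in>e. P p) \<and> (\<exists>q\<in>e. \<not> P q)}"
    by (rule inj_on_subset[OF inj_on_image_Pow[OF inj]]) (use CV in blast)
  then show ?thesis unfolding cut_size_def eq by (rule card_image)
qed

definition point_at :: "nat \<Rightarrow> nat \<Rightarrow> nat \<Rightarrow> point" where
  "point_at m n k = (if k \<le> n then Top k else if k \<le> n + m then Right (k - n)
     else if k \<le> 2 * n + m then Bottom (2 * n + m + 1 - k) else Left (2 * n + 2 * m + 1 - k))"

lemma mem_marked_points [simp]:
  "Top j \<in> marked_points m n \<longleftrightarrow> 1 \<le> j \<and> j \<le> n"
  "Bottom j \<in> marked_points m n \<longleftrightarrow> 1 \<le> j \<and> j \<le> n"
  "Left i \<in> marked_points m n \<longleftrightarrow> 1 \<le> i \<and> i \<le> m"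
  "Right i \<in> marked_points m n \<longleftrightarrow> 1 \<le> i \<and> i \<le> m"
  by (auto simp: marked_points_def)

lemma marked_points_cases:
  assumes "p \<in> marked_points m n"
  obtains j where "p = Top j" "1 \<le> j" "j \<le> n" | j where "p = Bottom j" "1 \<le> j" "j \<le> n"
    | i where "p = Left i" "1 \<le> i" "i \<le> m" | i where "p = Right i" "1 \<le> i" "i \<le> m"
  using assms unfolding marked_points_def by auto

lemma boundary_rank_bounds:
  "p \<in> marked_points m n \<Longrightarrow> boundary_rank m n p \<in> {1..2 * (m + n)}"
  by (erule marked_points_cases) auto

lemma point_at_boundary_rank:
  "p \<in> marked_points m n \<Longrightarrow> point_at m n (boundary_rank m n p) = p"
  by (erule marked_points_cases) (auto simp: point_at_def)

lemma point_at_marked: "k \<in> {1..2 * (m + n)} \<Longrightarrow> point_at m n k \<in> marked_points m n"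
  by (auto simp: point_at_def)

lemma boundary_rank_point_at: "k \<in> {1..2 * (m + n)} \<Longrightarrow> boundary_rank m n (point_at m n k) = k"
  by (auto simp: point_at_def)

lemma boundary_rank_inj: "inj_on (boundary_rank m n) (marked_points m n)"
  by (rule inj_on_inverseI[of _ "point_at m n"]) (rule point_at_boundary_rank)

lemma boundary_rank_image: "boundary_rank m n ` marked_points m n = {1..2 * (m + n)}"
proof
  show "boundary_rank m n ` marked_points m n \<subseteq> {1..2 * (m + n)}"
    using boundary_rank_bounds by blast
  show "{1..2 * (m + n)} \<subseteq> boundary_rank m n ` marked_points m n"
  proof
    fix k assume "k \<in> {1..2 * (m + n)}"
    then show "k \<in> boundary_rank m n ` marked_points m n"
      using boundary_rank_point_at[of k m n] point_at_marked[of k m n] by (metis image_eqI)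
  qed
qed

definition rank_matching :: "nat \<Rightarrow> nat \<Rightarrow> point set set \<Rightarrow> nat set set" where
  "rank_matching m n C = (`) (boundary_rank m n) ` C"

lemma catalan_statesD:
  assumes "C \<in> catalan_states m n"
  shows "perfect_matching (marked_points m n) C"
    "\<And>a b c d. {a, c} \<in> C \<Longrightarrow> {b, d} \<in> C \<Longrightarrow> boundary_rank m n a < boundary_rank m n b \<Longrightarrow>
      boundary_rank m n b < boundary_rank m n c \<Longrightarrow> boundary_rank m n c < boundary_rank m n d \<Longrightarrow> False"
  using assms unfolding catalan_states_def noncrossing_def mem_Collect_eq by blast+

lemma rank_matching_perfect:
  "perfect_matching (marked_points m n) C \<Longrightarrow> perfect_matching {1..2 * (m + n)} (rank_matching m n C)"
  using perfect_matching_image[OF boundary_rank_inj] unfolding rank_matching_def boundary_rank_image .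

lemma rank_matching_mem:
  assumes "perfect_matching (marked_points m n) C" "p \<in> marked_points m n" "q \<in> marked_points m n"
  shows "{boundary_rank m n p, boundary_rank m n q} \<in> rank_matching m n C \<longleftrightarrow> {p, q} \<in> C"
  using image_matching_mem[OF boundary_rank_inj assms] unfolding rank_matching_def .

lemma rank_matching_in_noncrossing:
  assumes C: "C \<in> catalan_states m n"
  shows "rank_matching m n C \<in> noncrossing_matchings {1..2 * (m + n)}"
  unfolding noncrossing_matchings_def mem_Collect_eq
proof (intro conjI notI)
  note pm = catalan_statesD(1)[OF C]
  note pm' = rank_matching_perfect[OF pm]
  show "perfect_matching {1..2 * (m + n)} (rank_matching m n C)" by (rule pm')
  assume "\<exists>a b c d. {a, c} \<in> rank_matching m n C \<and> {b, d} \<in> rank_matching m n C \<and> a < b \<and> b < c \<and> c < d"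
  then obtain a b c d where *: "{a, c} \<in> rank_matching m n C" "{b, d} \<in> rank_matching m n C" "a < b" "b < c" "c < d"
    by blast
  have V: "a \<in> {1..2 * (m + n)}" "c \<in> {1..2 * (m + n)}" "b \<in> {1..2 * (m + n)}" "d \<in> {1..2 * (m + n)}"
    using *(1,2) pm' unfolding perfect_matching_def by blast+
  let ?p = "point_at m n"
  have "{?p a, ?p c} \<in> C" "{?p b, ?p d} \<in> C"
    using rank_matching_mem[OF pm point_at_marked point_at_marked] boundary_rank_point_at V *(1,2) by metis+
  then show False
    by (rule catalan_statesD(2)[OF C]) (use *(3-5) V in \<open>simp_all only: boundary_rank_point_at\<close>)
qed

lemma rank_matching_bij:
  "bij_betw (rank_matching m n) (catalan_states m n) (noncrossing_matchings {1..2 * (m + n)})"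
proof (rule bij_betw_byWitness[where f' = "(`) ((`) (point_at m n))"])
  show "\<forall>C\<in>catalan_states m n. (`) (point_at m n) ` rank_matching m n C = C"
  proof
    fix C assume "C \<in> catalan_states m n"
    then have "C \<subseteq> Pow (marked_points m n)"
      using catalan_statesD(1) unfolding perfect_matching_def by blast
    then show "(`) (point_at m n) ` rank_matching m n C = C"
      unfolding rank_matching_def
      by (intro image_matching_inverse[where V = "marked_points m n"] point_at_boundary_rank)
  qed
  have inv: "rank_matching m n ((`) (point_at m n) ` D) = D"
    if "D \<in> noncrossing_matchings {1..2 * (m + n)}" for D
  proof -
    have "D \<subseteq> Pow {1..2 * (m + n)}"
      using noncrossing_matchingsD(1)[OF that] unfolding perfect_matching_def by blast
    then show ?thesis
      unfolding rank_matching_def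
      by (intro image_matching_inverse[where V = "{1..2 * (m + n)}"] boundary_rank_point_at)
  qed
  then show "\<forall>D\<in>noncrossing_matchings {1..2 * (m + n)}. rank_matching m n ((`) (point_at m n) ` D) = D"
    by blast
  show "rank_matching m n ` catalan_states m n \<subseteq> noncrossing_matchings {1..2 * (m + n)}"
    using rank_matching_in_noncrossing by blast
  show "(`) ((`) (point_at m n)) ` noncrossing_matchings {1..2 * (m + n)} \<subseteq> catalan_states m n"
  proof
    fix C assume "C \<in> (`) ((`) (point_at m n)) ` noncrossing_matchings {1..2 * (m + n)}"
    then obtain D where D: "D \<in> noncrossing_matchings {1..2 * (m + n)}" "C = (`) (point_at m n) ` D" by blast
    note pmD = noncrossing_matchingsD(1)[OF D(1)]
    have inj: "inj_on (point_at m n) {1..2 * (m + n)}"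
      by (rule inj_on_inverseI[of _ "boundary_rank m n"]) (rule boundary_rank_point_at)
    have "point_at m n ` {1..2 * (m + n)} = marked_points m n"
      unfolding boundary_rank_image[symmetric] using point_at_boundary_rank by (force simp: image_image)
    then have pm: "perfect_matching (marked_points m n) C"
      using perfect_matching_image[OF inj pmD] D(2) by simp
    have "noncrossing m n C"
      unfolding noncrossing_def
    proof (intro notI, elim exE conjE)
      fix a b c d
      assume *: "{a, c} \<in> C" "{b, d} \<in> C" "boundary_rank m n a < boundary_rank m n b"
        "boundary_rank m n b < boundary_rank m n c" "boundary_rank m n c < boundary_rank m n d"
      have V: "a \<in> marked_points m n" "c \<in> marked_points m n" "b \<in> marked_points m n" "d \<in> marked_points m n"
        using *(1,2) pm unfolding perfect_matching_def by blast+
      have "{boundary_rank m n a, boundary_rank m n c} \<in> D" "{boundary_rank m n b, boundary_rank m n d} \<in> D"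
        using rank_matching_mem[OF pm V(1,2)] rank_matching_mem[OF pm V(3,4)] *(1,2) inv[OF D(1)] D(2) by simp_all
      then show False by (rule noncrossing_matchingsD(2)[OF D(1) _ _ *(3-5)])
    qed
    then show "C \<in> catalan_states m n" using pm by (simp add: catalan_states_def)
  qed
qed

lemma line_intersections_eq_cut:
  assumes C: "perfect_matching (marked_points m n) C" and i: "i \<le> m"
  shows "line_intersections i C = cut_size {n + i<..2 * n + 2 * m - i} (rank_matching m n C)"
  unfolding line_intersections_def rank_matching_def
proof (rule cut_image[OF boundary_rank_inj C, symmetric])
  show "above_line i p \<longleftrightarrow> boundary_rank m n p \<notin> {n + i<..2 * n + 2 * m - i}"
    if "p \<in> marked_points m n" for p
    using that i by (cases rule: marked_points_cases) auto
qed

lemma d_h_exceeds: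
  assumes "C \<in> catalan_states m n" "m \<ge> 1"
  shows "d_h m C > n \<longleftrightarrow> (\<exists>i\<in>{1..m - 1}. n < cut_size {n + i<..2 * n + 2 * m - i} (rank_matching m n C))"
proof (cases "m = 1")
  case False
  then have "d_h m C > n \<longleftrightarrow> (\<exists>i\<in>{1..m - 1}. n < line_intersections i C)"
    using assms(2) by (simp add: d_h_def Max_gr_iff)
  also have "\<dots> \<longleftrightarrow> (\<exists>i\<in>{1..m - 1}. n < cut_size {n + i<..2 * n + 2 * m - i} (rank_matching m n C))"
    by (rule bex_cong[OF refl]) (use line_intersections_eq_cut[OF catalan_statesD(1)[OF assms(1)]] in auto)
  finally show ?thesis .
qed (simp add: d_h_def)

lemma card_filter_bij:
  assumes "bij_betw f A B" "\<And>x. x \<in> A \<Longrightarrow> P x \<longleftrightarrow> Q (f x)"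
  shows "card {x \<in> A. P x} = card {y \<in> B. Q y}"
proof -
  have "{x \<in> A. P x} = {x \<in> A. Q (f x)}"
    by (rule Collect_cong, rule conj_cong[OF refl], rule assms(2))
  moreover have "f ` {x \<in> A. Q (f x)} = {y \<in> B. Q y}"
    unfolding bij_betw_imp_surj_on[OF assms(1), symmetric] by (rule Compr_image_eq[symmetric])
  moreover have "card (f ` {x \<in> A. Q (f x)}) = card {x \<in> A. Q (f x)}"
    by (rule card_image, rule inj_on_subset[OF bij_betw_imp_inj_on[OF assms(1)]]) blast
  ultimately show ?thesis by (simp only:)
qed

lemma T_h_eq:
  assumes "m \<ge> 1"
  shows "T_h m n = card {D \<in> noncrossing_matchings {1..2 * (m + n)}.
    \<exists>i\<in>{1..m - 1}. n < cut_size {n + i<..2 * n + 2 * m - i} D}"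
  unfolding T_h_def by (rule card_filter_bij[OF rank_matching_bij]) (rule d_h_exceeds[OF _ assms])

section \<open>Reversal of the ranks and the vertical lines\<close>

text \<open>Transposing the rectangle keeps the top left corner and reverses the sense of traversal
  of the boundary, so rank \<open>k\<close> becomes \<open>2 * N + 1 - k\<close>.\<close>

definition reflect :: "nat \<Rightarrow> nat set set \<Rightarrow> nat set set" where
  "reflect N D = (`) (\<lambda>k. 2 * N + 1 - k) ` D"

lemma reflect_in_noncrossing:
  assumes D: "D \<in> noncrossing_matchings {1..2 * N}"
  shows "reflect N D \<in> noncrossing_matchings {1..2 * N}" "reflect N (reflect N D) = D"
proof -
  let ?r = "\<lambda>k. 2 * N + 1 - k"
  let ?V = "{1..2 * N}"
  note pm = noncrossing_matchingsD(1)[OF D]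
  have inv: "?r (?r k) = k" "?r k \<in> ?V" if "k \<in> ?V" for k using that by auto
  have inj: "inj_on ?r ?V" by (rule inj_on_inverseI[of _ ?r]) (rule inv(1))
  have img: "?r ` ?V = ?V"
  proof
    show "?V \<subseteq> ?r ` ?V" using inv by (metis image_eqI subsetI)
  qed (use inv(2) in blast)
  have pm': "perfect_matching ?V (reflect N D)"
    using perfect_matching_image[OF inj pm] unfolding img reflect_def .
  have DV: "D \<subseteq> Pow ?V" using pm unfolding perfect_matching_def by blast
  show invD: "reflect N (reflect N D) = D"
    unfolding reflect_def by (rule image_matching_inverse[OF _ DV]) (rule inv(1))
  have False if *: "{a, c} \<in> reflect N D" "{b, d} \<in> reflect N D" "a < b" "b < c" "c < d" for a b c d
  proof -
    have V: "a \<in> ?V" "c \<in> ?V" "b \<in> ?V" "d \<in> ?V"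
      using *(1,2) pm' unfolding perfect_matching_def by blast+
    have "{?r d, ?r b} \<in> D" "{?r c, ?r a} \<in> D"
      using image_matching_mem[OF inj pm' V(4,3)] image_matching_mem[OF inj pm' V(2,1)] *(1,2)
        invD[unfolded reflect_def[of N "reflect N D"]]
      by (simp_all add: insert_commute)
    then show False
      by (rule noncrossing_matchingsD(2)[OF D]) (use * V in auto)
  qed
  then show "reflect N D \<in> noncrossing_matchings ?V"
    unfolding noncrossing_matchings_def mem_Collect_eq using pm' by blast
qed

lemma reflect_bij:
  "bij_betw (reflect N) (noncrossing_matchings {1..2 * N}) (noncrossing_matchings {1..2 * N})"
  by (rule bij_betw_byWitness[where f' = "reflect N"]) (use reflect_in_noncrossing in blast)+

lemma cut_reflect:
  assumes D: "perfect_matching {1..2 * N} D" and "a \<le> b" "b \<le> 2 * N"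
  shows "cut_size {a<..b} (reflect N D) = cut_size {2 * N - b<..2 * N - a} D"
proof -
  have "inj_on (\<lambda>k. 2 * N + 1 - k) {1..2 * N}" by (auto simp: inj_on_def)
  then have "cut_size {a<..b} (reflect N D) = card {e \<in> D. (\<exists>p\<in>e. p \<notin> {2 * N - b<..2 * N - a}) \<and>
      (\<exists>q\<in>e. \<not> q \<notin> {2 * N - b<..2 * N - a})}"
    unfolding reflect_def by (rule cut_image[OF _ D]) (use assms in auto)
  also have "\<dots> = cut_size {2 * N - b<..2 * N - a} D"
    unfolding cut_size_def by (rule arg_cong[where f = card]) blast
  finally show ?thesis .
qed

text \<open>The horizontal lines of the transposed rectangle are the vertical lines of the given
  one; \<open>{j<..2 * n + m - j}\<close> contains the ranks of the points to the right of the line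
  between columns \<open>j\<close> and \<open>j + 1\<close>.\<close>

lemma T_h_transposed_eq:
  assumes "n \<ge> 1"
  shows "T_h n m = card {D \<in> noncrossing_matchings {1..2 * (m + n)}.
    \<exists>j\<in>{1..n - 1}. m < cut_size {j<..2 * n + m - j} D}"
proof -
  have "T_h n m = card {D \<in> noncrossing_matchings {1..2 * (m + n)}.
      \<exists>j\<in>{1..n - 1}. m < cut_size {m + j<..2 * m + 2 * n - j} D}"
    using T_h_eq[OF assms, of m] by (simp add: add.commute)
  also have "\<dots> = card {D \<in> noncrossing_matchings {1..2 * (m + n)}.
      \<exists>j\<in>{1..n - 1}. m < cut_size {j<..2 * n + m - j} D}"
  proof (rule sym, rule card_filter_bij[OF reflect_bij])
    fix D assume D: "D \<in> noncrossing_matchings {1..2 * (m + n)}"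
    have "cut_size {m + j<..2 * m + 2 * n - j} (reflect (m + n) D) = cut_size {j<..2 * n + m - j} D"
      if "j \<in> {1..n - 1}" for j
    proof -
      have "2 * (m + n) - (2 * m + 2 * n - j) = j" "2 * (m + n) - (m + j) = 2 * n + m - j"
        using that by auto
      then show ?thesis
        using cut_reflect[OF noncrossing_matchingsD(1)[OF D], of "m + j" "2 * m + 2 * n - j"] that by auto
    qed
    then show "(\<exists>j\<in>{1..n - 1}. m < cut_size {j<..2 * n + m - j} D) \<longleftrightarrow>
        (\<exists>j\<in>{1..n - 1}. m < cut_size {m + j<..2 * m + 2 * n - j} (reflect (m + n) D))"
      by simp
  qed
  finally show ?thesis .
qed

section \<open>A state cannot violate both kinds of line conditions\<close>

text \<open>Cut sizes are sums over arcs, so the inequality may be checked on one arc at a time.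
  Shorter inequalities are obtained by padding with empty sets.\<close>

lemma cut_add_le:
  assumes D: "perfect_matching V D" "finite V"
    and "\<And>x y. {x, y} \<in> D \<Longrightarrow> of_bool ((x \<in> A) \<noteq> (y \<in> A)) + of_bool ((x \<in> B) \<noteq> (y \<in> B))
      \<le> (of_bool ((x \<in> E) \<noteq> (y \<in> E)) + of_bool ((x \<in> F) \<noteq> (y \<in> F)) + of_bool ((x \<in> G) \<noteq> (y \<in> G)) :: nat)"
  shows "cut_size A D + cut_size B D \<le> cut_size E D + cut_size F D + cut_size G D"
proof -
  have "of_bool (e \<inter> A \<noteq> {} \<and> \<not> e \<subseteq> A) + of_bool (e \<inter> B \<noteq> {} \<and> \<not> e \<subseteq> B)
      \<le> (of_bool (e \<inter> E \<noteq> {} \<and> \<not> e \<subseteq> E) + of_bool (e \<inter> F \<noteq> {} \<and> \<not> e \<subseteq> F)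
        + of_bool (e \<inter> G \<noteq> {} \<and> \<not> e \<subseteq> G) :: nat)" if e: "e \<in> D" for e
  proof -
    obtain x y where xy: "e = {x, y}" using perfect_matching_arc[OF D(1) e] by metis
    have "{x, y} \<inter> X \<noteq> {} \<and> \<not> {x, y} \<subseteq> X \<longleftrightarrow> (x \<in> X) \<noteq> (y \<in> X)" for X by auto
    then show ?thesis using assms(3)[of x y] e unfolding xy by (simp only:)
  qed
  then show ?thesis
    unfolding cut_eq_sum[OF perfect_matching_finite[OF D]] sum.distrib[symmetric] by (rule sum_mono)
qed

text \<open>The four point condition for the dual tree of \<open>D\<close>.\<close>

lemma cut_four_points:
  assumes D: "D \<in> noncrossing_matchings V" "finite V" and g: "g1 \<le> g2" "g2 \<le> g3" "g3 \<le> g4"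
  shows "cut_size {g1<..g3} D + cut_size {g2<..g4} D \<le> cut_size {g2<..g3} D + cut_size {g1<..g4} D \<or>
    cut_size {g1<..g3} D + cut_size {g2<..g4} D \<le> cut_size {g1<..g2} D + cut_size {g3<..g4} D"
proof -
  define A B E where "A = {g1<..g2}" and "B = {g2<..g3}" and "E = {g3<..g4}"
  have un: "{g1<..g3} = A \<union> B" "{g2<..g4} = B \<union> E" "{g1<..g4} = A \<union> B \<union> E"
    using g by (auto simp: A_def B_def E_def)
  have disj: "\<not> (z \<in> A \<and> z \<in> B)" "\<not> (z \<in> A \<and> z \<in> E)" "\<not> (z \<in> B \<and> z \<in> E)" for z
    using g by (auto simp: A_def B_def E_def)
  note pm = noncrossing_matchingsD(1)[OF D(1)]
  \<comment> \<open>An arc from \<open>A\<close> to \<open>E\<close> would cross an arc from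
    \<open>B\<close> to the outside of all three intervals. With one of these two types absent, one
    of the inequalities holds for every single arc.\<close>
  consider "\<And>x y. {x, y} \<in> D \<Longrightarrow> \<not> (x \<in> A \<and> y \<in> E)"
    | "\<And>x y. {x, y} \<in> D \<Longrightarrow> \<not> (x \<in> B \<and> y \<notin> A \<union> B \<union> E)"
  proof (cases "\<exists>x y. {x, y} \<in> D \<and> x \<in> A \<and> y \<in> E")
    case True
    then obtain x y where xy: "{x, y} \<in> D" "g1 < x" "x \<le> g2" "g3 < y" "y \<le> g4"
      by (auto simp: A_def E_def)
    have "\<not> (z \<in> B \<and> w \<notin> A \<union> B \<union> E)" if zw: "{z, w} \<in> D" for z w
    proof
      assume "z \<in> B \<and> w \<notin> A \<union> B \<union> E"
      then have z: "g2 < z" "z \<le> g3" and w: "w \<le> g1 \<or> g4 < w"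
        using g unfolding un(3)[symmetric] by (auto simp: B_def)
      have wz: "{w, z} \<in> D" using zw by (simp add: insert_commute)
      from w show False
      proof
        assume "w \<le> g1"
        show False by (rule noncrossing_matchingsD(2)[OF D(1) wz xy(1)]) (use \<open>w \<le> g1\<close> z xy in linarith)+
      next
        assume "g4 < w"
        show False by (rule noncrossing_matchingsD(2)[OF D(1) xy(1) zw]) (use \<open>g4 < w\<close> z xy in linarith)+
      qed
    qed
    then show thesis by (rule that(2))
  next
    case False
    show thesis by (rule that(1)) (use False in blast)
  qed
  then show ?thesis
  proof cases
    case 1
    have "cut_size (A \<union> B) D + cut_size (B \<union> E) D \<le> cut_size B D + cut_size (A \<union> B \<union> E) D + cut_size {} D"
    proof (rule cut_add_le[OF pm D(2)])
      fix x y assume xy: "{x, y} \<in> D"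
      then have "{y, x} \<in> D" by (simp add: insert_commute)
      note no = 1[OF xy] 1[OF this]
      show "of_bool ((x \<in> A \<union> B) \<noteq> (y \<in> A \<union> B)) + of_bool ((x \<in> B \<union> E) \<noteq> (y \<in> B \<union> E))
        \<le> (of_bool ((x \<in> B) \<noteq> (y \<in> B)) + of_bool ((x \<in> A \<union> B \<union> E) \<noteq> (y \<in> A \<union> B \<union> E))
          + of_bool ((x \<in> {}) \<noteq> (y \<in> {})) :: nat)"
        by (cases "x \<in> A"; cases "x \<in> B"; cases "x \<in> E"; cases "y \<in> A"; cases "y \<in> B"; cases "y \<in> E")
          (use no disj in simp_all)
    qed
    then show ?thesis unfolding un by (simp add: A_def B_def E_def)
  next
    case 2
    have "cut_size (A \<union> B) D + cut_size (B \<union> E) D \<le> cut_size A D + cut_size E D + cut_size {} D"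
    proof (rule cut_add_le[OF pm D(2)])
      fix x y assume xy: "{x, y} \<in> D"
      then have "{y, x} \<in> D" by (simp add: insert_commute)
      note no = 2[OF xy] 2[OF this]
      show "of_bool ((x \<in> A \<union> B) \<noteq> (y \<in> A \<union> B)) + of_bool ((x \<in> B \<union> E) \<noteq> (y \<in> B \<union> E))
        \<le> (of_bool ((x \<in> A) \<noteq> (y \<in> A)) + of_bool ((x \<in> E) \<noteq> (y \<in> E))
          + of_bool ((x \<in> {}) \<noteq> (y \<in> {})) :: nat)"
        by (cases "x \<in> A"; cases "x \<in> B"; cases "x \<in> E"; cases "y \<in> A"; cases "y \<in> B"; cases "y \<in> E")
          (use no disj in simp_all)
    qed
    then show ?thesis unfolding un by (simp add: A_def B_def E_def)
  qed
qed

lemma cut_interval_le: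
  assumes D: "perfect_matching {1..2 * N} D" and "a \<le> b" "b \<le> 2 * N"
  shows "cut_size {a<..b} D \<le> b - a" "cut_size {a<..b} D \<le> 2 * N - (b - a)"
proof -
  have fin: "finite {1..2 * N}" by simp
  have sub: "{a<..b} \<subseteq> {1..2 * N}" using assms(3) by auto
  show "cut_size {a<..b} D \<le> b - a"
    using cut_le_card_and_parity[OF D fin sub] by simp
  have "cut_size {a<..b} D = cut_size ({1..2 * N} - {a<..b}) D" by (rule cut_complement[OF D, symmetric])
  also have "\<dots> \<le> card ({1..2 * N} - {a<..b})"
    by (rule cut_le_card_and_parity[OF D fin, THEN conjunct1]) auto
  also have "\<dots> = 2 * N - (b - a)"
    using assms(2,3) by (subst card_Diff_subset) auto
  finally show "cut_size {a<..b} D \<le> 2 * N - (b - a)" .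
qed

text \<open>The two lines divide the marked points among four corners, and each pair of opposite
  corners holds exactly \<open>m + n\<close> of them. This bounds both alternatives of the four
  point condition by \<open>m + n\<close>, while two violations add up to at least
  \<open>m + n + 2\<close>.\<close>

lemma horizontal_vertical_exclusive:
  assumes D: "D \<in> noncrossing_matchings {1..2 * (m + n)}"
    and i: "i \<in> {1..m - 1}" "n < cut_size {n + i<..2 * n + 2 * m - i} D"
    and j: "j \<in> {1..n - 1}" "m < cut_size {j<..2 * n + m - j} D"
  shows False
proof -
  note le = cut_interval_le[OF noncrossing_matchingsD(1)[OF D]]
  obtain i' j' where mn: "m = i + i'" "n = j + j'"
  proof
    show "m = i + (m - i)" "n = j + (n - j)" using i(1) j(1) by auto
  qed
  have "cut_size {j<..2 * n + m - j} D + cut_size {n + i<..2 * n + 2 * m - i} D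
        \<le> cut_size {n + i<..2 * n + m - j} D + cut_size {j<..2 * n + 2 * m - i} D \<or>
      cut_size {j<..2 * n + m - j} D + cut_size {n + i<..2 * n + 2 * m - i} D
        \<le> cut_size {j<..n + i} D + cut_size {2 * n + m - j<..2 * n + 2 * m - i} D"
    by (rule cut_four_points[OF D]) (use i(1) j(1) in auto)
  moreover have "cut_size {n + i<..2 * n + m - j} D \<le> 2 * n + m - j - (n + i)"
    by (rule le(1)) (use i(1) j(1) in auto)
  moreover have "cut_size {j<..2 * n + 2 * m - i} D \<le> 2 * (m + n) - (2 * n + 2 * m - i - j)"
    by (rule le(2)) (use i(1) j(1) in auto)
  moreover have "cut_size {j<..n + i} D \<le> n + i - j"
    by (rule le(1)) (use i(1) j(1) in auto)
  moreover have "cut_size {2 * n + m - j<..2 * n + 2 * m - i} D \<le> 2 * n + 2 * m - i - (2 * n + m - j)"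
    by (rule le(1)) (use i(1) j(1) in auto)
  ultimately show False
    using i(2) j(2) unfolding mn by simp
qed

section \<open>Realizable states satisfy the line conditions\<close>

lemma perfect_matching_same:
  "perfect_matching V C \<Longrightarrow> e \<in> C \<Longrightarrow> f \<in> C \<Longrightarrow> p \<in> e \<Longrightarrow> p \<in> f \<Longrightarrow> e = f"
  using perfect_matching_disjoint[of V C] by (auto simp: disjoint_def)

lemma equivclpI: "r x y \<Longrightarrow> equivclp r x y"
  unfolding equivclp_def by (blast intro: symclpI)

lemma equivclp_preserves:
  assumes "equivclp r x y" "\<And>u v. r u v \<Longrightarrow> f u = f v"
  shows "f x = f y"
  using assms(1)
proof (induction rule: equivclp_induct)
  case (step y z)
  then show ?case using assms(2)[of y z] assms(2)[of z y] by auto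
qed simp

lemma smoothed_diagram_mem:
  assumes "p \<in> marked_points m n" "q \<in> marked_points m n" "p \<noteq> q"
  shows "{p, q} \<in> smoothed_diagram m n s \<longleftrightarrow> equivclp (smoothing m n s) (end_edge m n p) (end_edge m n q)"
proof
  assume "{p, q} \<in> smoothed_diagram m n s"
  then obtain p' q' where *: "{p, q} = {p', q'}" "equivclp (smoothing m n s) (end_edge m n p') (end_edge m n q')"
    unfolding smoothed_diagram_def by blast
  then show "equivclp (smoothing m n s) (end_edge m n p) (end_edge m n q)"
    by (metis doubleton_eq_iff equivclp_sym)
next
  assume "equivclp (smoothing m n s) (end_edge m n p) (end_edge m n q)"
  then show "{p, q} \<in> smoothed_diagram m n s"
    unfolding smoothed_diagram_def using assms by blast
qed

text \<open>The edges \<open>VEdge i j\<close>, which the line itself crosses, count as below it, so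
  a strand changes sides only on entering or leaving one of them.\<close>

fun edge_above :: "nat \<Rightarrow> edge \<Rightarrow> bool" where
  "edge_above i (HEdge i' j) \<longleftrightarrow> i' \<le> i"
| "edge_above i (VEdge i' j) \<longleftrightarrow> i' < i"

lemma smoothing_crosses_line:
  assumes "smoothing m n s x y" "edge_above i x \<noteq> edge_above i y"
  shows "\<exists>j\<in>{1..n}. x = VEdge i j \<or> y = VEdge i j"
  using assms by (cases rule: smoothing.cases) auto

lemma path_crosses_line:
  assumes "equivclp (smoothing m n s) x y" "edge_above i x" "\<not> edge_above i y"
  shows "\<exists>j\<in>{1..n}. equivclp (smoothing m n s) x (VEdge i j)"
proof (rule ccontr)
  assume no: "\<not> ?thesis"
  have "edge_above i y" using assms(1)
  proof (induction rule: equivclp_induct)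
    case base then show ?case by (rule assms(2))
  next
    case (step y z)
    have xz: "equivclp (smoothing m n s) x z"
      using step.hyps by (metis equivclpI equivclp_sym equivclp_trans)
    show ?case
    proof (rule ccontr)
      assume "\<not> edge_above i z"
      then have "\<exists>j\<in>{1..n}. y = VEdge i j \<or> z = VEdge i j"
        using step smoothing_crosses_line by metis
      then show False using no step.hyps(1) xz by blast
    qed
  qed
  then show False using assms(3) by simp
qed

lemma end_edge_above:
  assumes "p \<in> marked_points m n" "1 \<le> i" "i < m"
  shows "edge_above i (end_edge m n p) \<longleftrightarrow> above_line i p"
  using assms by (cases rule: marked_points_cases) auto

lemma realizable_line_intersections:
  assumes C: "C \<in> realizable_states m n" and i: "1 \<le> i" "i < m"
  shows "line_intersections i C \<le> n"
proof -
  obtain s where s: "smoothed_diagram m n s = C" and pm: "perfect_matching (marked_points m n) C"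
    using C catalan_statesD(1) unfolding realizable_states_def by blast
  let ?eq = "equivclp (smoothing m n s)"
  let ?E = "{e \<in> C. (\<exists>p\<in>e. above_line i p) \<and> (\<exists>q\<in>e. \<not> above_line i q)}"
  have "\<exists>j. j \<in> {1..n} \<and> (\<exists>p\<in>e. above_line i p \<and> ?eq (end_edge m n p) (VEdge i j))" if e: "e \<in> ?E" for e
  proof -
    obtain p q where pq: "p \<in> e" "above_line i p" "q \<in> e" "\<not> above_line i q" using e by blast
    have "p \<noteq> q" using pq by blast
    have V: "p \<in> marked_points m n" "q \<in> marked_points m n"
      using e pq pm unfolding perfect_matching_def by blast+
    have "e \<in> C" using e by simp
    then obtain x y where "e = {x, y}" by (rule perfect_matching_arc[OF pm])
    then have "e = {p, q}" using pq \<open>p \<noteq> q\<close> by blast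
    then have "?eq (end_edge m n p) (end_edge m n q)"
      using smoothed_diagram_mem[OF V \<open>p \<noteq> q\<close>, of s] e s by simp
    then show ?thesis
      using path_crosses_line[of m n s _ _ i] end_edge_above[OF V(1) i] end_edge_above[OF V(2) i] pq
      by blast
  qed
  then have "\<forall>e\<in>?E. \<exists>j. j \<in> {1..n} \<and> (\<exists>p\<in>e. above_line i p \<and> ?eq (end_edge m n p) (VEdge i j))"
    by (rule ballI)
  from bchoice[OF this] obtain f where "\<forall>e\<in>?E. f e \<in> {1..n} \<and>
      (\<exists>p\<in>e. above_line i p \<and> ?eq (end_edge m n p) (VEdge i (f e)))" ..
  note f = bspec[OF this]
  have "inj_on f ?E"
  proof (rule inj_onI)
    fix e e' assume e: "e \<in> ?E" "e' \<in> ?E" "f e = f e'"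
    obtain p where p: "p \<in> e" "above_line i p" "?eq (end_edge m n p) (VEdge i (f e))"
      using f[OF e(1)] by blast
    obtain p' where p': "p' \<in> e'" "above_line i p'" "?eq (end_edge m n p') (VEdge i (f e))"
      using f[OF e(2)] e(3) by auto
    have V: "p \<in> marked_points m n" "p' \<in> marked_points m n"
      using e p(1) p'(1) pm unfolding perfect_matching_def by blast+
    have eq: "?eq (end_edge m n p) (end_edge m n p')"
      using p(3) p'(3) by (meson equivclp_sym equivclp_trans)
    \<comment> \<open>Two arcs sharing an edge of the line belong to one component. If their ends
      above the line differed, \<open>e\<close> would consist of these two ends and would not cross
      the line.\<close>
    have "p = p'"
    proof (rule ccontr)
      assume "p \<noteq> p'"
      then have "{p, p'} \<in> C" using smoothed_diagram_mem[OF V, of s] eq s by simp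
      then have "e = {p, p'}" using perfect_matching_same[OF pm _ _ p(1)] e(1) by simp
      then show False using e(1) p(2) p'(2) by blast
    qed
    then show "e = e'" using perfect_matching_same[OF pm _ _ p(1)] e(1,2) p'(1) by simp
  qed
  moreover have "f ` ?E \<subseteq> {1..n}" using f by blast
  ultimately have "card ?E \<le> card {1..n}" by (rule card_inj_on_le) simp
  then show ?thesis by (simp add: line_intersections_def)
qed

section \<open>Transposition of realizable states\<close>

fun transpose_point :: "point \<Rightarrow> point" where
  "transpose_point (Top j) = Left j"
| "transpose_point (Left i) = Top i"
| "transpose_point (Bottom j) = Right j"
| "transpose_point (Right i) = Bottom i"

fun transpose_edge :: "edge \<Rightarrow> edge" where
  "transpose_edge (HEdge i j) = VEdge j i"
| "transpose_edge (VEdge i j) = HEdge j i"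

lemma transpose_point_transpose_point [simp]: "transpose_point (transpose_point p) = p"
  by (cases p) auto

lemma transpose_point_marked: "p \<in> marked_points m n \<Longrightarrow> transpose_point p \<in> marked_points n m"
  by (erule marked_points_cases) auto

lemma end_edge_transpose: "end_edge n m (transpose_point p) = transpose_edge (end_edge m n p)"
  by (cases p) auto

lemma boundary_rank_transpose:
  "p \<in> marked_points m n \<Longrightarrow> boundary_rank n m (transpose_point p) = 2 * (m + n) + 1 - boundary_rank m n p"
  by (erule marked_points_cases) auto

text \<open>Transposition preserves each of the two smoothings, hence the markers. The closure
  appears in the conclusion because the transposed pair may be listed in the opposite order.\<close>

lemma smoothing_transpose:
  assumes "smoothing m n s x y"
  shows "equivclp (smoothing n m (\<lambda>(j, i). s (i, j))) (transpose_edge x) (transpose_edge y)"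
  using assms
proof cases
  case (top_right i j)
  then show ?thesis
    using smoothing.left_bottom[of j n i m "\<lambda>(j, i). s (i, j)"] by (auto intro: equivclpI)
next
  case (left_bottom i j)
  then show ?thesis
    using smoothing.top_right[of j n i m "\<lambda>(j, i). s (i, j)"] by (auto intro: equivclpI)
next
  case (top_left i j)
  then show ?thesis
    using smoothing.top_left[of j n i m "\<lambda>(j, i). s (i, j)"] by (auto intro: equivclpI equivclp_sym)
next
  case (right_bottom i j)
  then show ?thesis
    using smoothing.right_bottom[of j n i m "\<lambda>(j, i). s (i, j)"] by (auto intro: equivclpI equivclp_sym)
qed

lemma equivclp_smoothing_transpose:
  assumes "equivclp (smoothing m n s) x y"
  shows "equivclp (smoothing n m (\<lambda>(j, i). s (i, j))) (transpose_edge x) (transpose_edge y)"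
  using assms
proof (induction rule: equivclp_induct)
  case base then show ?case by simp
next
  case (step y z)
  then have "equivclp (smoothing n m (\<lambda>(j, i). s (i, j))) (transpose_edge y) (transpose_edge z)"
    using smoothing_transpose equivclp_sym by metis
  with step.IH show ?case by (rule equivclp_trans)
qed

lemma transpose_realizable:
  assumes C: "C \<in> realizable_states m n"
  defines "C' \<equiv> (`) transpose_point ` C"
  shows "C' \<in> realizable_states n m" "rank_matching n m C' = reflect (m + n) (rank_matching m n C)"
proof -
  obtain s where s: "smoothed_diagram m n s = C" and cat: "C \<in> catalan_states m n"
    using C unfolding realizable_states_def by blast
  note pm = catalan_statesD(1)[OF cat]
  have "(\<lambda>p. boundary_rank n m (transpose_point p)) ` e = (\<lambda>p. 2 * (m + n) + 1 - boundary_rank m n p) ` e"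
    if "e \<in> C" for e
  proof -
    have "e \<subseteq> marked_points m n" using pm that unfolding perfect_matching_def by blast
    then have "boundary_rank n m (transpose_point p) = 2 * (m + n) + 1 - boundary_rank m n p" if "p \<in> e" for p
      using boundary_rank_transpose that by blast
    then show ?thesis by (rule image_cong[OF refl])
  qed
  then show rank: "rank_matching n m C' = reflect (m + n) (rank_matching m n C)"
    unfolding rank_matching_def reflect_def C'_def image_image by (rule image_cong[OF refl])
  have inj: "inj_on transpose_point (marked_points m n)"
    by (rule inj_on_inverseI[of _ transpose_point]) simp
  have img: "transpose_point ` marked_points m n = marked_points n m"
  proof
    show "transpose_point ` marked_points m n \<subseteq> marked_points n m" using transpose_point_marked by blast
    show "marked_points n m \<subseteq> transpose_point ` marked_points m n"
      using transpose_point_marked transpose_point_transpose_point by (metis image_eqI subsetI)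
  qed
  have pm': "perfect_matching (marked_points n m) C'"
    using perfect_matching_image[OF inj pm] unfolding img C'_def .
  have nc': "rank_matching n m C' \<in> noncrossing_matchings {1..2 * (m + n)}"
    unfolding rank by (rule reflect_in_noncrossing(1)[OF rank_matching_in_noncrossing[OF cat]])
  have "noncrossing n m C'"
    unfolding noncrossing_def
  proof (intro notI, elim exE conjE)
    fix a b c d
    assume *: "{a, c} \<in> C'" "{b, d} \<in> C'" "boundary_rank n m a < boundary_rank n m b"
      "boundary_rank n m b < boundary_rank n m c" "boundary_rank n m c < boundary_rank n m d"
    have V: "a \<in> marked_points n m" "c \<in> marked_points n m" "b \<in> marked_points n m" "d \<in> marked_points n m"
      using *(1,2) pm' unfolding perfect_matching_def by blast+
    show False
      using noncrossing_matchingsD(2)[OF nc' _ _ *(3-5)] *(1,2)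
        rank_matching_mem[OF pm' V(1,2)] rank_matching_mem[OF pm' V(3,4)] by blast
  qed
  then have cat': "C' \<in> catalan_states n m" using pm' by (simp add: catalan_states_def)
  have "smoothed_diagram n m (\<lambda>(j, i). s (i, j)) = C'"
  proof -
    \<comment> \<open>Transposing the state twice returns it, so the one-directional lemma yields an
      equivalence.\<close>
    have s2: "(\<lambda>(j, i). (\<lambda>(j, i). s (i, j)) (i, j)) = s" by auto
    have iff: "equivclp (smoothing n m (\<lambda>(j, i). s (i, j))) (end_edge n m p) (end_edge n m q) \<longleftrightarrow>
        equivclp (smoothing m n s) (end_edge m n (transpose_point p)) (end_edge m n (transpose_point q))" for p q
    proof -
      have "equivclp (smoothing m n s) (transpose_edge (end_edge n m p)) (transpose_edge (end_edge n m q))"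
        if "equivclp (smoothing n m (\<lambda>(j, i). s (i, j))) (end_edge n m p) (end_edge n m q)"
        using equivclp_smoothing_transpose[OF that] unfolding s2 .
      moreover have "equivclp (smoothing n m (\<lambda>(j, i). s (i, j))) (end_edge n m p) (end_edge n m q)"
        if "equivclp (smoothing m n s) (end_edge m n (transpose_point p)) (end_edge m n (transpose_point q))"
        using equivclp_smoothing_transpose[OF that] unfolding end_edge_transpose[symmetric] by simp
      ultimately show ?thesis unfolding end_edge_transpose by blast
    qed
    have mem: "{p, q} \<in> smoothed_diagram n m (\<lambda>(j, i). s (i, j)) \<longleftrightarrow> {p, q} \<in> C'"
      if V: "p \<in> marked_points n m" "q \<in> marked_points n m" "p \<noteq> q" for p q
    proof -
      have V': "transpose_point p \<in> marked_points m n" "transpose_point q \<in> marked_points m n"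
        using V transpose_point_marked by blast+
      have "transpose_point p \<noteq> transpose_point q" using V(3) by (metis transpose_point_transpose_point)
      then have "{p, q} \<in> smoothed_diagram n m (\<lambda>(j, i). s (i, j)) \<longleftrightarrow> {transpose_point p, transpose_point q} \<in> C"
        using smoothed_diagram_mem[OF V] smoothed_diagram_mem[OF V', of s] iff s by simp
      also have "\<dots> \<longleftrightarrow> {p, q} \<in> C'"
        using image_matching_mem[OF inj pm V'] by (simp add: C'_def)
      finally show ?thesis .
    qed
    show ?thesis
    proof
      show "smoothed_diagram n m (\<lambda>(j, i). s (i, j)) \<subseteq> C'"
        using mem unfolding smoothed_diagram_def by blast
      show "C' \<subseteq> smoothed_diagram n m (\<lambda>(j, i). s (i, j))"
      proof
        fix e assume e: "e \<in> C'"
        obtain p q where "e = {p, q}" "p \<noteq> q" "p \<in> marked_points n m" "q \<in> marked_points n m"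
          using perfect_matching_arc[OF pm' e] by metis
        then show "e \<in> smoothed_diagram n m (\<lambda>(j, i). s (i, j))" using mem e by simp
      qed
    qed
  qed
  then show "C' \<in> realizable_states n m" using cat' unfolding realizable_states_def by blast
qed

section \<open>The ends of the components\<close>

lemma even_sum_adjacent:
  fixes a :: "nat \<Rightarrow> nat"
  shows "even (\<Sum>i=1..m. a (i - 1) + a i) \<longleftrightarrow> even (a 0 + a m)"
proof (induction m)
  case (Suc m)
  then show ?case by (simp add: sum.cl_ivl_Suc) presburger
qed simp

lemma even_sum_cong:
  assumes "finite A" "\<And>x. x \<in> A \<Longrightarrow> even (f x :: nat) \<longleftrightarrow> even (g x)"
  shows "even (sum f A) \<longleftrightarrow> even (sum g A)"
proof -
  have "{x \<in> A. odd (f x)} = {x \<in> A. odd (g x)}" using assms(2) by blast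
  then show ?thesis using assms(1) by (simp add: even_sum_iff)
qed

lemma sum_marked_points:
  "(\<Sum>p\<in>marked_points m n. f p) =
    (\<Sum>j=1..n. f (Top j) + f (Bottom j)) + (\<Sum>i=1..m. f (Left i) + f (Right i) :: nat)"
proof -
  have inj: "inj_on Top A" "inj_on Bottom A" "inj_on Left A" "inj_on Right A" for A
    by (auto simp: inj_on_def)
  have "(\<Sum>p\<in>marked_points m n. f p) = sum f (Top ` {1..n} \<union> Bottom ` {1..n} \<union> Left ` {1..m}) + sum f (Right ` {1..m})"
    unfolding marked_points_def by (rule sum.union_disjoint) auto
  also have "sum f (Top ` {1..n} \<union> Bottom ` {1..n} \<union> Left ` {1..m}) =
      sum f (Top ` {1..n} \<union> Bottom ` {1..n}) + sum f (Left ` {1..m})"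
    by (rule sum.union_disjoint) auto
  also have "sum f (Top ` {1..n} \<union> Bottom ` {1..n}) = sum f (Top ` {1..n}) + sum f (Bottom ` {1..n})"
    by (rule sum.union_disjoint) auto
  finally show ?thesis by (simp add: sum.reindex inj sum.distrib)
qed

text \<open>Every crossing has an even number of its four ends in a union \<open>P\<close> of components.\<close>

lemma even_boundary_points:
  assumes P: "\<And>x y. smoothing m n s x y \<Longrightarrow> P x \<longleftrightarrow> P y"
  shows "even (card {p \<in> marked_points m n. P (end_edge m n p)})"
proof -
  define f where "f x = (of_bool (P x) :: nat)" for x
  have cross: "even (f (VEdge (i - 1) j) + f (VEdge i j)) \<longleftrightarrow> even (f (HEdge i (j - 1)) + f (HEdge i j))"
    if "i \<in> {1..m}" "j \<in> {1..n}" for i j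
  proof (cases "s (i, j)")
    case Positive
    show ?thesis
      using P[OF smoothing.top_right[of i m j n s, OF that Positive]] P[OF smoothing.left_bottom[of i m j n s, OF that Positive]]
      by (auto simp: f_def)
  next
    case Negative
    show ?thesis
      using P[OF smoothing.top_left[of i m j n s, OF that Negative]] P[OF smoothing.right_bottom[of i m j n s, OF that Negative]]
      by (auto simp: f_def)
  qed
  \<comment> \<open>Modulo 2 the inner edges of every segment cancel. The ends of the vertical
    segments thus give a sum over all crossings, which is converted at each crossing into the one
    for the horizontal segments.\<close>
  have "even (\<Sum>j=1..n. f (VEdge 0 j) + f (VEdge m j)) \<longleftrightarrow>
      even (\<Sum>j=1..n. \<Sum>i=1..m. f (VEdge (i - 1) j) + f (VEdge i j))"
  proof (rule even_sum_cong)
    show "even (f (VEdge 0 j) + f (VEdge m j)) \<longleftrightarrow> even (\<Sum>i=1..m. f (VEdge (i - 1) j) + f (VEdge i j))" for j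
      by (rule even_sum_adjacent[where a = "\<lambda>i. f (VEdge i j)", symmetric])
  qed simp
  also have "\<dots> \<longleftrightarrow> even (\<Sum>i=1..m. \<Sum>j=1..n. f (VEdge (i - 1) j) + f (VEdge i j))"
    by (subst sum.swap) (rule refl)
  also have "\<dots> \<longleftrightarrow> even (\<Sum>i=1..m. \<Sum>j=1..n. f (HEdge i (j - 1)) + f (HEdge i j))"
    by (intro even_sum_cong) (use cross in auto)
  also have "\<dots> \<longleftrightarrow> even (\<Sum>i=1..m. f (HEdge i 0) + f (HEdge i n))"
  proof (rule even_sum_cong)
    show "even (\<Sum>j=1..n. f (HEdge i (j - 1)) + f (HEdge i j)) \<longleftrightarrow> even (f (HEdge i 0) + f (HEdge i n))" for i
      by (rule even_sum_adjacent[where a = "\<lambda>j. f (HEdge i j)"])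
  qed simp
  finally have "even (\<Sum>p\<in>marked_points m n. f (end_edge m n p))"
    unfolding sum_marked_points by simp
  moreover have "finite (marked_points m n)" by (simp add: marked_points_def)
  ultimately show ?thesis by (simp add: even_sum_iff f_def Collect_conj_eq)
qed

text \<open>Parity replaces following the strand: a component cannot contain \<open>p\<close> as its
  only marked point. Which other point it contains is decided later by the labels of edges.\<close>

lemma component_second_point:
  assumes p: "p \<in> marked_points m n"
  obtains q where "q \<in> marked_points m n" "q \<noteq> p"
    "equivclp (smoothing m n s) (end_edge m n p) (end_edge m n q)"
proof -
  let ?A = "{q \<in> marked_points m n. equivclp (smoothing m n s) (end_edge m n p) (end_edge m n q)}"
  have even: "even (card ?A)"
  proof (rule even_boundary_points)
    fix x y assume "smoothing m n s x y"
    then have "equivclp (smoothing m n s) x y" by (rule equivclpI)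
    then show "equivclp (smoothing m n s) (end_edge m n p) x \<longleftrightarrow> equivclp (smoothing m n s) (end_edge m n p) y"
      by (meson equivclp_sym equivclp_trans)
  qed
  have "p \<in> ?A" using p by simp
  have "?A \<noteq> {p}"
  proof
    assume "?A = {p}"
    then have "card ?A = 1" by (simp only: card_Suc_eq card.empty is_singletonI is_singleton_altdef[symmetric])
    then show False using even by simp
  qed
  then obtain q where "q \<in> ?A" "q \<noteq> p" using \<open>p \<in> ?A\<close> by blast
  then show ?thesis using that by blast
qed

section \<open>Lipschitz maps from the grid to a plane tree\<close>

definition grid_dist :: "nat \<times> nat \<Rightarrow> nat \<times> nat \<Rightarrow> int" where
  "grid_dist x y = \<bar>int (fst x) - int (fst y)\<bar> + \<bar>int (snd x) - int (snd y)\<bar>"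

lemma grid_dist_self [simp]: "grid_dist x x = 0"
  by (simp add: grid_dist_def)

lemma grid_dist_commute: "grid_dist x y = grid_dist y x"
  by (simp add: grid_dist_def)

lemma grid_dist_triangle: "grid_dist x z \<le> grid_dist x y + grid_dist y z"
  by (simp add: grid_dist_def)

lemma even_grid_dist: "even (grid_dist (i, j) (k, l)) \<longleftrightarrow> even (i + j + (k + l))"
  unfolding grid_dist_def by simp presburger

text \<open>The cell between the boundary points of ranks \<open>g\<close> and \<open>g + 1\<close>, where \<open>(i, j)\<close> is the cell of
  \<open>L(m,n)\<close> between rows \<open>i\<close>, \<open>i + 1\<close> and columns \<open>j\<close>, \<open>j + 1\<close>.\<close>

definition cell_at :: "nat \<Rightarrow> nat \<Rightarrow> nat \<Rightarrow> nat \<times> nat" where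
  "cell_at m n g = (if g \<le> n then (0, g) else if g \<le> n + m then (g - n, n)
     else if g \<le> 2 * n + m then (m, 2 * n + m - g) else (2 * n + 2 * m - g, 0))"

lemma even_grid_dist_cell_at:
  assumes "g \<le> 2 * (m + n)"
  shows "even (grid_dist (i, j) (cell_at m n g)) \<longleftrightarrow> even (i + j + g)"
proof -
  have "even (grid_dist (i, j) (cell_at m n g)) \<longleftrightarrow> even (i + j + (fst (cell_at m n g) + snd (cell_at m n g)))"
    using even_grid_dist[of i j "fst (cell_at m n g)" "snd (cell_at m n g)"] by simp
  moreover have "even (fst (cell_at m n g) + snd (cell_at m n g)) \<longleftrightarrow> even g"
    using assms by (auto simp: cell_at_def)
  ultimately show ?thesis by simp
qed

text \<open>\<open>h\<close> is the height function of a Dyck path, so its values describe positions in a plane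
  tree, in which the distance of \<open>a\<close> and \<open>b\<close> is \<open>h a + h b - 2 * Min {h g | a \<le> g \<le> b}\<close>.
  Assumption \<open>lipschitz\<close> bounds it by the distance in the grid.\<close>

locale boundary_height =
  fixes m n :: nat and h :: "nat \<Rightarrow> int"
  assumes start: "h 0 = 0"
    and step: "g < 2 * (m + n) \<Longrightarrow> h (Suc g) = h g + 1 \<or> h g = h (Suc g) + 1"
    and lipschitz: "a \<le> g \<Longrightarrow> g \<le> b \<Longrightarrow> b \<le> 2 * (m + n) \<Longrightarrow>
      h a + h b \<le> grid_dist (cell_at m n a) (cell_at m n b) + 2 * h g"
begin

lemma even_h: "g \<le> 2 * (m + n) \<Longrightarrow> even (h g) \<longleftrightarrow> even g"
proof (induction g)
  case (Suc g)
  then have "even (h g) \<longleftrightarrow> even g" by simp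
  moreover have "h (Suc g) = h g + 1 \<or> h g = h (Suc g) + 1" using step[of g] Suc.prems by simp
  ultimately show ?case by auto
qed (simp add: start)

lemma lipschitz_between:
  assumes "min a b \<le> g" "g \<le> max a b" "a \<le> 2 * (m + n)" "b \<le> 2 * (m + n)"
  shows "h a + h b \<le> grid_dist (cell_at m n a) (cell_at m n b) + 2 * h g"
  using lipschitz[of a g b] lipschitz[of b g a] assms
  by (cases "a \<le> b") (auto simp: grid_dist_commute)

text \<open>Extension of the Lipschitz map from the boundary cells to all cells: a cell is sent to
  the point of the tree at height \<open>level x\<close> below any boundary cell attaining the maximum. A
  point of the tree is represented by its height \<open>l\<close> and the set of boundary cells above it.
  Negative heights are possible: they extend the tree by a path at its root.\<close>

definition level :: "nat \<times> nat \<Rightarrow> int" where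
  "level x = Max ((\<lambda>g. h g - grid_dist x (cell_at m n g)) ` {..2 * (m + n)})"

definition attains :: "nat \<times> nat \<Rightarrow> nat \<Rightarrow> bool" where
  "attains x g \<longleftrightarrow> g \<le> 2 * (m + n) \<and> h g - grid_dist x (cell_at m n g) = level x"

definition component :: "nat \<Rightarrow> int \<Rightarrow> nat set" where
  "component g l = {k. k \<le> 2 * (m + n) \<and> (\<forall>t. min g k \<le> t \<longrightarrow> t \<le> max g k \<longrightarrow> l \<le> h t)}"

definition vertex :: "nat \<times> nat \<Rightarrow> int \<times> nat set" where
  "vertex x = (level x, \<Union>g\<in>{g. attains x g}. component g (level x))"

lemma level_ge: "g \<le> 2 * (m + n) \<Longrightarrow> h g - grid_dist x (cell_at m n g) \<le> level x"
  unfolding level_def by (rule Max_ge) auto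

lemma attains_exists: obtains g where "attains x g"
proof -
  have "level x \<in> (\<lambda>g. h g - grid_dist x (cell_at m n g)) ` {..2 * (m + n)}"
    unfolding level_def by (rule Max_in) auto
  then show ?thesis using that unfolding attains_def by auto
qed

lemma component_subset:
  assumes "\<And>t. min g g' \<le> t \<Longrightarrow> t \<le> max g g' \<Longrightarrow> l \<le> h t"
  shows "component g l \<subseteq> component g' l"
proof
  fix k assume k: "k \<in> component g l"
  have "l \<le> h t" if "min g' k \<le> t" "t \<le> max g' k" for t
  proof (cases "min g k \<le> t \<and> t \<le> max g k")
    case True
    then show ?thesis using k by (simp add: component_def)
  next
    case False
    then show ?thesis using that by (intro assms) linarith+
  qed
  then show "k \<in> component g' l" using k by (simp add: component_def)
qed

text \<open>By the triangle inequality through \<open>x\<close>, \<open>h g + h g'\<close> is at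
  least \<open>2 * level x\<close> plus the distance of the two cells. The Lipschitz bound then
  forces \<open>level x \<le> h t\<close> for all \<open>t\<close> between \<open>g\<close> and
  \<open>g'\<close>, so descending from either cell leads to the same point of the tree.\<close>

lemma component_attains:
  assumes "attains x g" "attains x g'"
  shows "component g (level x) = component g' (level x)"
proof -
  have le: "level x \<le> h t" if "min g g' \<le> t" "t \<le> max g g'" for t
    using lipschitz_between[OF that] assms grid_dist_triangle[of "cell_at m n g" "cell_at m n g'" x]
    by (simp add: attains_def grid_dist_commute)
  show ?thesis
  proof
    show "component g (level x) \<subseteq> component g' (level x)"
      by (rule component_subset) (rule le)
    show "component g' (level x) \<subseteq> component g (level x)"
      by (rule component_subset) (use le in \<open>simp add: min.commute max.commute\<close>)
  qed
qed

lemma vertex_eq: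
  assumes "attains x g"
  shows "vertex x = (level x, component g (level x))"
proof -
  have "(\<Union>g'\<in>{g'. attains x g'}. component g' (level x)) = component g (level x)"
    using component_attains[OF assms] assms by blast
  then show ?thesis unfolding vertex_def by simp
qed

lemma even_level: "even (level (i, j)) \<longleftrightarrow> even (i + j)"
proof -
  obtain g where "attains (i, j) g" by (rule attains_exists)
  then have g: "g \<le> 2 * (m + n)" "level (i, j) = h g - grid_dist (i, j) (cell_at m n g)"
    by (auto simp: attains_def)
  show ?thesis unfolding g(2) using even_h[OF g(1)] even_grid_dist_cell_at[OF g(1), of i j] by auto
qed

lemma level_step_le:
  assumes "grid_dist x y = 1"
  shows "level x \<le> level y + 1"
proof -
  obtain g where "attains x g" by (rule attains_exists)
  then show ?thesis
    using level_ge[of g y] grid_dist_triangle[of y "cell_at m n g" x] assms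
    by (simp add: attains_def grid_dist_commute)
qed

text \<open>The triangle inequality bounds the difference by one, and parity excludes
  equality.\<close>

lemma level_step:
  assumes "grid_dist (i, j) (i', j') = 1"
  shows "level (i, j) = level (i', j') + 1 \<or> level (i', j') = level (i, j) + 1"
proof -
  have "odd (i + j + (i' + j'))"
    using even_grid_dist[of i j i' j'] assms by simp
  then have "level (i, j) \<noteq> level (i', j')"
    using even_level[of i j] even_level[of i' j'] by auto
  moreover have "level (i', j') \<le> level (i, j) + 1"
    by (rule level_step_le) (use assms in \<open>simp add: grid_dist_commute\<close>)
  ultimately show ?thesis using level_step_le[OF assms] by linarith
qed

lemma attains_lower:
  assumes "grid_dist x y = 1" "level y = level x - 1" "attains x g"
  shows "attains y g"
  using assms level_ge[of g y] grid_dist_triangle[of y "cell_at m n g" x]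
  by (simp add: attains_def grid_dist_commute)

text \<open>A boundary cell attaining the level of \<open>x\<close> also attains that of every lower
  neighbour, so all lower neighbours are sent to the parent of the vertex of
  \<open>x\<close>.\<close>

lemma vertex_lower_unique:
  assumes "grid_dist x y = 1" "level y = level x - 1" "grid_dist x z = 1" "level z = level x - 1"
  shows "vertex y = vertex z"
proof -
  obtain g where g: "attains x g" by (rule attains_exists)
  have "vertex y = (level y, component g (level y))"
    by (rule vertex_eq[OF attains_lower[OF assms(1,2) g]])
  moreover have "vertex z = (level z, component g (level z))"
    by (rule vertex_eq[OF attains_lower[OF assms(3,4) g]])
  ultimately show ?thesis using assms(2,4) by simp
qed

text \<open>A closed walk of length four in a tree backtracks.\<close>

lemma vertex_crossing:
  assumes "1 \<le> i" "1 \<le> j"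
  shows "vertex (i - 1, j - 1) = vertex (i, j) \<or> vertex (i - 1, j) = vertex (i, j - 1)"
proof -
  let ?NW = "(i - 1, j - 1)" and ?NE = "(i - 1, j)" and ?SW = "(i, j - 1)" and ?SE = "(i, j)"
  have d: "grid_dist ?NW ?NE = 1" "grid_dist ?NW ?SW = 1" "grid_dist ?SE ?NE = 1" "grid_dist ?SE ?SW = 1"
    "grid_dist ?NE ?NW = 1" "grid_dist ?NE ?SE = 1" "grid_dist ?SW ?NW = 1" "grid_dist ?SW ?SE = 1"
  proof -
    obtain a b where "i = Suc a" "j = Suc b" using assms by (metis Suc_le_D One_nat_def)
    then show "grid_dist ?NW ?NE = 1" "grid_dist ?NW ?SW = 1" "grid_dist ?SE ?NE = 1" "grid_dist ?SE ?SW = 1"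
      "grid_dist ?NE ?NW = 1" "grid_dist ?NE ?SE = 1" "grid_dist ?SW ?NW = 1" "grid_dist ?SW ?SE = 1"
      by (simp_all add: grid_dist_def)
  qed
  note s = level_step[OF d(1)] level_step[OF d(2)] level_step[OF d(3)] level_step[OF d(4)]
  \<comment> \<open>The cases locate a cell of greatest level among the four. Both of its neighbours
    around the crossing are lower, hence have the same vertex, and they are opposite cells.\<close>
  show ?thesis
  proof (cases "level ?NE < level ?NW")
    case NE: True
    then have ne: "level ?NE = level ?NW - 1" using s(1) by auto
    show ?thesis
    proof (cases "level ?SW < level ?NW")
      case True
      then have "level ?SW = level ?NW - 1" using s(2) by auto
      then show ?thesis using vertex_lower_unique[OF d(1) ne d(2)] by simp
    next
      case False
      then have nw: "level ?NW = level ?SW - 1" using s(2) by auto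
      moreover have "level ?SE \<le> level ?NE + 1" using s(3) by auto
      ultimately have "level ?SE = level ?SW - 1" using s(4) ne by auto
      then show ?thesis using vertex_lower_unique[OF d(7) nw d(8)] by simp
    qed
  next
    case NE: False
    then have nw: "level ?NW = level ?NE - 1" using s(1) by auto
    show ?thesis
    proof (cases "level ?SE < level ?NE")
      case True
      then have "level ?SE = level ?NE - 1" using s(3) by auto
      then show ?thesis using vertex_lower_unique[OF d(5) nw d(6)] by simp
    next
      case False
      then have ne: "level ?NE = level ?SE - 1" using s(3) by auto
      moreover have "level ?SW \<le> level ?NW + 1" using s(2) by auto
      ultimately have "level ?SW = level ?SE - 1" using s(4) nw by auto
      then show ?thesis using vertex_lower_unique[OF d(3) ne d(4)] by simp
    qed
  qed
qed

text \<open>The vertices of the cells on the two sides of the edge; they name the tree edge, hence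
  the arc, that a strand through it must follow.\<close>

fun label :: "edge \<Rightarrow> (int \<times> nat set) set" where
  "label (VEdge i j) = {vertex (i, j - 1), vertex (i, j)}"
| "label (HEdge i j) = {vertex (i - 1, j), vertex (i, j)}"

text \<open>The positive smoothing joins top with right and left with bottom, which merges the upper
  left and lower right cells. When these differ, \<open>vertex_crossing\<close> makes the other two
  equal, as the negative smoothing requires.\<close>

definition state :: kauffman_state where
  "state = (\<lambda>(i, j). if vertex (i - 1, j - 1) = vertex (i, j) then Positive else Negative)"

lemma smoothing_label:
  assumes "smoothing m n state x y"
  shows "label x = label y"
  using assms
proof cases
  case (top_right i j)
  then have "vertex (i - 1, j - 1) = vertex (i, j)" by (simp add: state_def split: if_splits)
  then show ?thesis using top_right by auto
next
  case (left_bottom i j)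
  then have "vertex (i - 1, j - 1) = vertex (i, j)" by (simp add: state_def split: if_splits)
  then show ?thesis using left_bottom by auto
next
  case (top_left i j)
  then have "vertex (i - 1, j) = vertex (i, j - 1)"
    using vertex_crossing[of i j] by (auto simp: state_def split: if_splits)
  then show ?thesis using top_left by auto
next
  case (right_bottom i j)
  then have "vertex (i - 1, j) = vertex (i, j - 1)"
    using vertex_crossing[of i j] by (auto simp: state_def split: if_splits)
  then show ?thesis using right_bottom by auto
qed

lemma attains_cell_at:
  assumes "g \<le> 2 * (m + n)"
  shows "attains (cell_at m n g) g" "level (cell_at m n g) = h g"
proof -
  have "level (cell_at m n g) = h g"
  proof (rule antisym)
    obtain k where k: "attains (cell_at m n g) k" by (rule attains_exists)
    then show "level (cell_at m n g) \<le> h g"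
      using lipschitz_between[of g k g] assms by (simp add: attains_def)
    show "h g \<le> level (cell_at m n g)" using level_ge[OF assms, of "cell_at m n g"] by simp
  qed
  then show "attains (cell_at m n g) g" "level (cell_at m n g) = h g"
    using assms by (simp_all add: attains_def)
qed

lemma vertex_cell_at:
  "g \<le> 2 * (m + n) \<Longrightarrow> vertex (cell_at m n g) = (h g, component g (h g))"
  using vertex_eq[OF attains_cell_at(1)] attains_cell_at(2) by simp

lemma label_end_edge:
  assumes "p \<in> marked_points m n"
  defines "k \<equiv> boundary_rank m n p"
  shows "label (end_edge m n p) = {vertex (cell_at m n (k - 1)), vertex (cell_at m n k)}"
  using assms(1)
proof (cases rule: marked_points_cases)
  case (1 j)
  then have "cell_at m n (k - 1) = (0, j - 1)" "cell_at m n k = (0, j)"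
    by (auto simp: k_def cell_at_def)
  then show ?thesis using 1 by simp
next
  case (2 j)
  then have "cell_at m n (k - 1) = (m, j)" "cell_at m n k = (m, j - 1)"
    by (auto simp: k_def cell_at_def)
  then show ?thesis using 2 by (simp add: insert_commute)
next
  case (3 i)
  then have "cell_at m n (k - 1) = (i, 0)" "cell_at m n k = (i - 1, 0)"
    by (auto simp: k_def cell_at_def)
  then show ?thesis using 3 by (simp add: insert_commute)
next
  case (4 i)
  then have "cell_at m n (k - 1) = (i - 1, n)" "cell_at m n k = (i, n)"
    by (auto simp: k_def cell_at_def)
  then show ?thesis using 4 by simp
qed

text \<open>Equal labels belong to an up step and the down step matched with it.\<close>

lemma equal_labels_matched:
  assumes kl: "1 \<le> k" "k < l" "l \<le> 2 * (m + n)"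
    and eq: "{vertex (cell_at m n (k - 1)), vertex (cell_at m n k)} =
      {vertex (cell_at m n (l - 1)), vertex (cell_at m n l)}"
  shows "h k = h (k - 1) + 1" "h l = h k - 1" "\<And>t. k \<le> t \<Longrightarrow> t < l \<Longrightarrow> h k \<le> h t"
proof -
  have comp: "h a = h b \<and> (\<forall>t. a \<le> t \<longrightarrow> t \<le> b \<longrightarrow> h a \<le> h t)"
    if "vertex (cell_at m n a) = vertex (cell_at m n b)" "a \<le> b" "b \<le> 2 * (m + n)" for a b
  proof -
    have "(h a, component a (h a)) = (h b, component b (h b))"
      using that(1) unfolding vertex_cell_at[OF order_trans[OF that(2,3)]] vertex_cell_at[OF that(3)] .
    then have *: "h a = h b" "component a (h a) = component b (h b)"
      unfolding prod.inject by blast+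
    have "b \<in> component b (h b)" using that by (auto simp: component_def)
    then have "b \<in> component a (h a)" unfolding *(2) .
    then show ?thesis using *(1) that(2) by (simp add: component_def)
  qed
  have st: "h k = h (k - 1) + 1 \<or> h (k - 1) = h k + 1" using step[of "k - 1"] kl by auto
  \<comment> \<open>Otherwise both steps would traverse the tree edge in the same direction. Then
    \<open>h (k - 1) \<le> h k\<close> and \<open>h k \<le> h (l - 1) = h (k - 1)\<close>, although
    consecutive heights differ.\<close>
  have "vertex (cell_at m n (k - 1)) = vertex (cell_at m n l) \<and> vertex (cell_at m n k) = vertex (cell_at m n (l - 1))"
  proof (rule ccontr)
    assume "\<not> ?thesis"
    then have eq': "vertex (cell_at m n (k - 1)) = vertex (cell_at m n (l - 1))"
      "vertex (cell_at m n k) = vertex (cell_at m n l)"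
      using eq by (auto simp: doubleton_eq_iff)
    have "h (k - 1) = h (l - 1) \<and> (\<forall>t. k - 1 \<le> t \<longrightarrow> t \<le> l - 1 \<longrightarrow> h (k - 1) \<le> h t)"
      by (rule comp[OF eq'(1)]) (use kl in auto)
    then have "h (k - 1) \<le> h k" "h (l - 1) = h (k - 1)" using kl by auto
    moreover have "h k = h l \<and> (\<forall>t. k \<le> t \<longrightarrow> t \<le> l \<longrightarrow> h k \<le> h t)"
      by (rule comp[OF eq'(2)]) (use kl in auto)
    then have "h k \<le> h (l - 1)" using kl by auto
    ultimately show False using st by simp
  qed
  then have a: "vertex (cell_at m n (k - 1)) = vertex (cell_at m n l)"
    and b: "vertex (cell_at m n k) = vertex (cell_at m n (l - 1))" by auto
  have A: "h (k - 1) = h l" "\<And>t. k - 1 \<le> t \<Longrightarrow> t \<le> l \<Longrightarrow> h (k - 1) \<le> h t"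
  proof -
    have "h (k - 1) = h l \<and> (\<forall>t. k - 1 \<le> t \<longrightarrow> t \<le> l \<longrightarrow> h (k - 1) \<le> h t)"
      by (rule comp[OF a]) (use kl in auto)
    then show "h (k - 1) = h l" "\<And>t. k - 1 \<le> t \<Longrightarrow> t \<le> l \<Longrightarrow> h (k - 1) \<le> h t" by blast+
  qed
  have B: "\<And>t. k \<le> t \<Longrightarrow> t \<le> l - 1 \<Longrightarrow> h k \<le> h t"
  proof -
    have "h k = h (l - 1) \<and> (\<forall>t. k \<le> t \<longrightarrow> t \<le> l - 1 \<longrightarrow> h k \<le> h t)"
      by (rule comp[OF b]) (use kl in auto)
    then show "\<And>t. k \<le> t \<Longrightarrow> t \<le> l - 1 \<Longrightarrow> h k \<le> h t" by blast
  qed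
  show up: "h k = h (k - 1) + 1" using st A(2)[of k] kl by auto
  show "h l = h k - 1" using up A(1) by simp
  show "h k \<le> h t" if "k \<le> t" "t < l" for t using B[of t] that by simp
qed

end

section \<open>Sufficiency of the line conditions\<close>

text \<open>An arc cut at both \<open>a\<close> and \<open>b\<close> has one end up to
  \<open>a\<close> and the other beyond \<open>b\<close>, so it is cut at \<open>g\<close> too and
  is paid for by the doubled term. An arc cut at only one of them has exactly one end in
  \<open>{a<..b}\<close>.\<close>

lemma cut_lipschitz:
  fixes a b g N :: nat
  assumes D: "perfect_matching {1..2 * N} D" and g: "a \<le> g" "g \<le> b"
  shows "cut_size {..a} D + cut_size {..b} D \<le> cut_size {a<..b} D + 2 * cut_size {..g} D"
proof -
  have "cut_size {..a} D + cut_size {..b} D \<le> cut_size {a<..b} D + cut_size {..g} D + cut_size {..g} D"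
  proof (rule cut_add_le[OF D])
    fix x y
    have b: "z \<in> {..b} \<longleftrightarrow> z \<in> {..a} \<or> z \<in> {a<..b}" and ab: "\<not> (z \<in> {..a} \<and> z \<in> {a<..b})"
      and ag: "z \<in> {..a} \<longrightarrow> z \<in> {..g}" and gb: "z \<in> {..g} \<longrightarrow> z \<in> {..b}" for z
      using g by auto
    show "of_bool ((x \<in> {..a}) \<noteq> (y \<in> {..a})) + of_bool ((x \<in> {..b}) \<noteq> (y \<in> {..b}))
      \<le> (of_bool ((x \<in> {a<..b}) \<noteq> (y \<in> {a<..b})) + of_bool ((x \<in> {..g}) \<noteq> (y \<in> {..g}))
         + of_bool ((x \<in> {..g}) \<noteq> (y \<in> {..g})) :: nat)"
      using b[of x] b[of y] ab[of x] ab[of y] ag[of x] ag[of y] gb[of x] gb[of y]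
      by (cases "x \<in> {..a}"; cases "x \<in> {a<..b}"; cases "x \<in> {..g}"; cases "y \<in> {..a}";
          cases "y \<in> {a<..b}"; cases "y \<in> {..g}") (simp_all only: of_bool_eq simp_thms)
  qed simp
  then show ?thesis by simp
qed

lemma cut_move_end:
  fixes a b b' N :: nat
  assumes D: "perfect_matching {1..2 * N} D" and "a \<le> b" "a \<le> b'" "b \<le> 2 * N" "b' \<le> 2 * N"
  shows "int (cut_size {a<..b} D) \<le> int (cut_size {a<..b'} D) + \<bar>int b - int b'\<bar>"
proof -
  let ?I = "{min b b'<..max b b'}"
  have "cut_size {a<..b} D + cut_size {} D \<le> cut_size {a<..b'} D + cut_size ?I D + cut_size {} D"
  proof (rule cut_add_le[OF D])
    fix x y
    have I: "z \<in> ?I \<longleftrightarrow> (z \<in> {a<..b}) \<noteq> (z \<in> {a<..b'})" for z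
      using assms(2,3) by (auto simp: min_def max_def)
    show "of_bool ((x \<in> {a<..b}) \<noteq> (y \<in> {a<..b})) + of_bool ((x \<in> {}) \<noteq> (y \<in> {}))
      \<le> (of_bool ((x \<in> {a<..b'}) \<noteq> (y \<in> {a<..b'})) + of_bool ((x \<in> ?I) \<noteq> (y \<in> ?I))
         + of_bool ((x \<in> {}) \<noteq> (y \<in> {})) :: nat)"
      unfolding I
      by (cases "x \<in> {a<..b}"; cases "x \<in> {a<..b'}"; cases "y \<in> {a<..b}"; cases "y \<in> {a<..b'}")
        (simp_all only: of_bool_eq simp_thms empty_iff)
  qed simp
  moreover have "cut_size ?I D \<le> max b b' - min b b'"
    by (rule cut_interval_le(1)[OF D]) (use assms in auto)
  moreover have "int (max b b' - min b b') = \<bar>int b - int b'\<bar>" by (simp add: max_def min_def)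
  ultimately show ?thesis unfolding cut_empty by linarith
qed

text \<open>If the cells lie on opposite sides of the rectangle, one of them is moved along its side
  until it faces the other across a line, each move costing at most one arc and exactly one unit of
  distance. Otherwise a stretch of the boundary realizes the grid distance, and counting its marked
  points suffices.\<close>

lemma cut_le_grid_dist:
  assumes D: "perfect_matching {1..2 * (m + n)} D"
    and hor: "\<And>i. i \<in> {1..m - 1} \<Longrightarrow> cut_size {n + i<..2 * n + 2 * m - i} D \<le> n"
    and ver: "\<And>j. j \<in> {1..n - 1} \<Longrightarrow> cut_size {j<..2 * n + m - j} D \<le> m"
    and ab: "a \<le> b" "b \<le> 2 * (m + n)"
  shows "int (cut_size {a<..b} D) \<le> grid_dist (cell_at m n a) (cell_at m n b)"
proof -
  note le = cut_interval_le[OF D ab]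
  \<comment> \<open>The values \<open>0\<close> and \<open>m\<close> stand for the top and bottom
    sides, which carry only \<open>n\<close> points each.\<close>
  have hor': "cut_size {n + i<..2 * n + 2 * m - i} D \<le> n" if "i \<le> m" for i
  proof (cases "i \<in> {1..m - 1}")
    case True then show ?thesis by (rule hor)
  next
    case False
    then have "i = 0 \<or> i = m" using that by auto
    then show ?thesis
      using cut_interval_le[OF D, of "n + i" "2 * n + 2 * m - i"] that by auto
  qed
  have ver': "cut_size {j<..2 * n + m - j} D \<le> m" if "j \<le> n" for j
  proof (cases "j \<in> {1..n - 1}")
    case True then show ?thesis by (rule ver)
  next
    case False
    then have "j = 0 \<or> j = n" using that by auto
    then show ?thesis
      using cut_interval_le[OF D, of j "2 * n + m - j"] that by auto
  qed
  consider "a \<le> n" "n + m < b" "b \<le> 2 * n + m" | "n < a" "a \<le> n + m" "2 * n + m < b"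
    | "a \<le> n" "2 * n + m < b" | "a \<le> n" "b \<le> n + m" | "n < a" "a \<le> n + m" "b \<le> 2 * n + m" | "n + m < a"
    by linarith
  then show ?thesis
  proof cases
    case 1
    have "int (cut_size {a<..b} D) \<le> int (cut_size {a<..2 * n + m - a} D) + \<bar>int b - int (2 * n + m - a)\<bar>"
      by (rule cut_move_end[OF D]) (use 1 ab in auto)
    moreover have "cell_at m n a = (0, a)" "cell_at m n b = (m, 2 * n + m - b)"
      using 1 by (auto simp: cell_at_def)
    ultimately show ?thesis using ver'[of a] 1 by (simp add: grid_dist_def of_nat_diff)
  next
    case 2
    have "2 * n + 2 * m - (a - n) = 3 * n + 2 * m - a" using 2 by simp
    then have "cut_size {a<..3 * n + 2 * m - a} D \<le> n" using hor'[of "a - n"] 2 by simp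
    moreover have "int (cut_size {a<..b} D) \<le> int (cut_size {a<..3 * n + 2 * m - a} D) + \<bar>int b - int (3 * n + 2 * m - a)\<bar>"
      by (rule cut_move_end[OF D]) (use 2 ab in auto)
    moreover have "cell_at m n a = (a - n, n)" "cell_at m n b = (2 * n + 2 * m - b, 0)"
      using 2 by (auto simp: cell_at_def)
    ultimately show ?thesis using 2 ab by (simp add: grid_dist_def of_nat_diff)
  next
    case 3
    have "cell_at m n a = (0, a)" "cell_at m n b = (2 * n + 2 * m - b, 0)"
      using 3 by (auto simp: cell_at_def)
    then show ?thesis using le(2) 3 ab by (simp add: grid_dist_def of_nat_diff)
  next
    case 4
    then have "grid_dist (cell_at m n a) (cell_at m n b) = int b - int a"
      using ab by (cases "b \<le> n") (simp_all add: grid_dist_def cell_at_def of_nat_diff)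
    then show ?thesis using le(1) ab by linarith
  next
    case 5
    then have "grid_dist (cell_at m n a) (cell_at m n b) = int b - int a"
      using ab by (cases "b \<le> n + m") (simp_all add: grid_dist_def cell_at_def of_nat_diff)
    then show ?thesis using le(1) ab by linarith
  next
    case 6
    then have "grid_dist (cell_at m n a) (cell_at m n b) = int b - int a"
      using ab by (cases "a \<le> 2 * n + m"; cases "b \<le> 2 * n + m") (simp_all add: grid_dist_def cell_at_def of_nat_diff)
    then show ?thesis using le(1) ab by linarith
  qed
qed

text \<open>Matching of parentheses: any other arc open just after \<open>k\<close> must enclose the
  arc from \<open>k\<close> to \<open>q\<close>, so it stays open throughout, and at
  \<open>q\<close> the arc itself closes.\<close>

lemma cut_under_arc:
  assumes D: "D \<in> noncrossing_matchings V" "finite V" and kq: "{k, q} \<in> D" "k < q"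
  shows "\<And>t. k \<le> t \<Longrightarrow> t < q \<Longrightarrow> cut_size {..k} D \<le> cut_size {..t} D" "cut_size {..q} D < cut_size {..k} D"
proof -
  let ?S = "\<lambda>t. {e \<in> D. e \<inter> {..t} \<noteq> {} \<and> \<not> e \<subseteq> {..t}}"
  note pm = noncrossing_matchingsD(1)[OF D(1)] and nc = noncrossing_matchingsD(2)[OF D(1)]
  have fin: "finite (?S t)" for t using perfect_matching_finite[OF pm D(2)] by simp
  have arc: "\<exists>x y. e = {x, y} \<and> x \<le> t \<and> t < y \<and> {x, y} \<in> D" if e: "e \<in> ?S t" for e t
  proof -
    have "e \<in> D" using e by simp
    then obtain x y where "e = {x, y}" by (rule perfect_matching_arc[OF pm])
    moreover from this have "x \<le> t \<and> t < y \<or> y \<le> t \<and> t < x" using e by auto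
    ultimately show ?thesis using \<open>e \<in> D\<close>
      by (elim disjE conjE; metis insert_commute)
  qed
  have mem: "{x, y} \<in> ?S t" if "{x, y} \<in> D" "x \<le> t" "t < y" for x y t using that by auto
  have qk: "{q, k} \<in> D" using kq(1) by (simp add: insert_commute)
  show "cut_size {..k} D \<le> cut_size {..t} D" if t: "k \<le> t" "t < q" for t
    unfolding cut_size_def
  proof (rule card_mono[OF fin], rule subsetI)
    fix e assume "e \<in> ?S k"
    then obtain x y where e: "e = {x, y}" "x \<le> k" "k < y" "{x, y} \<in> D" using arc by blast
    have "t < y"
    proof (cases "x = k")
      case True
      then show ?thesis using perfect_matching_unique[OF pm kq(1)] e(4) t by auto
    next
      case False
      show ?thesis
      proof (rule ccontr)
        assume "\<not> t < y"
        then have "y < q" using t by simp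
        moreover have "x < k" using False e(2) by simp
        ultimately show False using nc[OF e(4) kq(1)] e(3) by blast
      qed
    qed
    then show "e \<in> ?S t" unfolding e(1) using e t by (intro mem) auto
  qed
  show "cut_size {..q} D < cut_size {..k} D"
    unfolding cut_size_def
  proof (rule psubset_card_mono[OF fin], rule psubsetI)
    show "?S q \<subseteq> ?S k"
    proof
      fix e assume "e \<in> ?S q"
      then obtain x y where e: "e = {x, y}" "x \<le> q" "q < y" "{x, y} \<in> D" using arc by blast
      have "x \<noteq> q" using perfect_matching_unique[OF pm qk, of y] e kq by auto
      then have "x \<le> k" using nc[OF kq(1) e(4)] e by (meson le_neq_implies_less not_le)
      then show "e \<in> ?S k" unfolding e(1) using e kq by (intro mem) auto
    qed
    have "{k, q} \<in> ?S k" "{k, q} \<notin> ?S q" using kq by auto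
    then show "?S q \<noteq> ?S k" by blast
  qed
qed

lemma realizable_if_line_conditions:
  assumes C: "C \<in> catalan_states m n"
    and hor: "\<And>i. i \<in> {1..m - 1} \<Longrightarrow> cut_size {n + i<..2 * n + 2 * m - i} (rank_matching m n C) \<le> n"
    and ver: "\<And>j. j \<in> {1..n - 1} \<Longrightarrow> cut_size {j<..2 * n + m - j} (rank_matching m n C) \<le> m"
  shows "C \<in> realizable_states m n"
proof -
  define D where "D = rank_matching m n C"
  let ?V = "{1..2 * (m + n)}"
  have D: "D \<in> noncrossing_matchings ?V" unfolding D_def by (rule rank_matching_in_noncrossing[OF C])
  note pm = noncrossing_matchingsD(1)[OF D] and pmC = catalan_statesD(1)[OF C]
  define h where "h g = int (cut_size {..g} D)" for g
  have Suc: "h (Suc g) = h g + 1 \<or> h g = h (Suc g) + 1" if "g < 2 * (m + n)" for g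
    using cut_insert[OF pm, of "Suc g" "{..g}"] that by (auto simp: h_def atMost_Suc)
  interpret boundary_height m n h
  proof
    have "cut_size {..0} D = cut_size {} D" by (rule cut_cong[OF pm]) simp
    then show "h 0 = 0" by (simp add: h_def)
    show "h (Suc g) = h g + 1 \<or> h g = h (Suc g) + 1" if "g < 2 * (m + n)" for g
      by (rule Suc[OF that])
    show "h a + h b \<le> grid_dist (cell_at m n a) (cell_at m n b) + 2 * h g"
      if g: "a \<le> g" "g \<le> b" "b \<le> 2 * (m + n)" for a b g
    proof -
      have "int (cut_size {a<..b} D) \<le> grid_dist (cell_at m n a) (cell_at m n b)"
        by (rule cut_le_grid_dist[OF pm]) (use hor ver g in \<open>auto simp: D_def\<close>)
      then show ?thesis using cut_lipschitz[OF pm g(1,2)] by (simp add: h_def)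
    qed
  qed
  \<comment> \<open>Joined points have equal labels, so their ranks are an up step and the down step
    matched with it in the Dyck path of \<open>D\<close>.\<close>
  have ranks: "{boundary_rank m n p, boundary_rank m n q} \<in> D"
    if V: "p \<in> marked_points m n" "q \<in> marked_points m n" and less: "boundary_rank m n p < boundary_rank m n q"
      and eq: "equivclp (smoothing m n state) (end_edge m n p) (end_edge m n q)" for p q
  proof -
    let ?k = "boundary_rank m n p" and ?l = "boundary_rank m n q"
    have kl: "?k \<in> ?V" "?l \<in> ?V" using boundary_rank_bounds V by blast+
    have "label (end_edge m n p) = label (end_edge m n q)"
      by (rule equivclp_preserves[OF eq smoothing_label])
    then have lab: "{vertex (cell_at m n (?k - 1)), vertex (cell_at m n ?k)} =
        {vertex (cell_at m n (?l - 1)), vertex (cell_at m n ?l)}"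
      unfolding label_end_edge[OF V(1)] label_end_edge[OF V(2)] .
    note matched = equal_labels_matched[OF _ less _ lab]
    have up: "h ?k = h (?k - 1) + 1" "h ?l = h ?k - 1" "\<And>t. ?k \<le> t \<Longrightarrow> t < ?l \<Longrightarrow> h ?k \<le> h t"
      using matched kl by auto
    obtain q' where q': "{?k, q'} \<in> D" using perfect_matching_partner[OF pm kl(1)] by metis
    have "q' \<noteq> ?k" "q' \<in> ?V" using pm q' unfolding perfect_matching_def by fastforce+
    have "insert ?k {..?k - 1} = {..?k}" using kl(1) by auto
    moreover have "if q' \<in> {..?k - 1} then cut_size {..?k - 1} D = cut_size (insert ?k {..?k - 1}) D + 1
        else cut_size (insert ?k {..?k - 1}) D = cut_size {..?k - 1} D + 1"
      by (rule cut_insert_cases[OF pm _ kl(1) _ q']) (use kl(1) in auto)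
    \<comment> \<open>A partner with smaller rank would make \<open>?k\<close> a down step.\<close>
    ultimately have "q' \<notin> {..?k - 1}" using up(1) by (auto simp: h_def split: if_splits)
    then have kq: "?k < q'" using \<open>q' \<noteq> ?k\<close> by auto
    note under = cut_under_arc[OF D _ q' kq]
    \<comment> \<open>Both are the first rank after \<open>?k\<close> at which the height falls
      below \<open>h ?k\<close>.\<close>
    have "q' = ?l"
    proof (rule linorder_cases[of q' ?l])
      assume "q' < ?l"
      then show ?thesis using up(3)[of q'] under(2) kq by (simp add: h_def)
    next
      assume "?l < q'"
      then show ?thesis using under(1)[of ?l] up(2) less by (simp add: h_def)
    qed simp
    then show ?thesis using q' by simp
  qed
  have arcs: "{p, q} \<in> C"
    if V: "p \<in> marked_points m n" "q \<in> marked_points m n" and "p \<noteq> q"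
      and eq: "equivclp (smoothing m n state) (end_edge m n p) (end_edge m n q)" for p q
  proof -
    have "boundary_rank m n p \<noteq> boundary_rank m n q"
      using inj_onD[OF boundary_rank_inj _ V] \<open>p \<noteq> q\<close> by blast
    then have "{boundary_rank m n p, boundary_rank m n q} \<in> D"
      using ranks[OF V _ eq] ranks[OF V(2,1) _ equivclp_sym[OF eq]]
      by (metis insert_commute linorder_neqE_nat)
    then show ?thesis using rank_matching_mem[OF pmC V] by (simp add: D_def)
  qed
  have "smoothed_diagram m n state = C"
  proof
    show "smoothed_diagram m n state \<subseteq> C"
      using arcs unfolding smoothed_diagram_def by blast
    show "C \<subseteq> smoothed_diagram m n state"
    proof
      fix e assume e: "e \<in> C"
      obtain p q where pq: "e = {p, q}" "p \<noteq> q" "p \<in> marked_points m n" "q \<in> marked_points m n"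
        using perfect_matching_arc[OF pmC e] by metis
      \<comment> \<open>The strand from \<open>p\<close> reaches some other marked point, and
        \<open>arcs\<close> leaves only the partner of \<open>p\<close> for it.\<close>
      obtain r where r: "r \<in> marked_points m n" "r \<noteq> p"
        "equivclp (smoothing m n state) (end_edge m n p) (end_edge m n r)"
        by (rule component_second_point[OF pq(3)])
      have "{p, r} \<in> C" by (rule arcs[OF pq(3) r(1) _ r(3)]) (use r(2) in simp)
      then have "r = q" using perfect_matching_unique[OF pmC] e pq(1) by blast
      then show "e \<in> smoothed_diagram m n state"
        using smoothed_diagram_mem[OF pq(3,4,2)] r(3) pq(1) by simp
    qed
  qed
  then show ?thesis using C unfolding realizable_states_def by blast
qed

section \<open>Characterization and count of the realizable states\<close>

lemma realizable_iff:
  assumes C: "C \<in> catalan_states m n"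
  shows "C \<in> realizable_states m n \<longleftrightarrow>
    \<not> (\<exists>i\<in>{1..m - 1}. n < cut_size {n + i<..2 * n + 2 * m - i} (rank_matching m n C)) \<and>
    \<not> (\<exists>j\<in>{1..n - 1}. m < cut_size {j<..2 * n + m - j} (rank_matching m n C))"
    (is "?R \<longleftrightarrow> \<not> ?H \<and> \<not> ?V")
proof
  assume R: ?R
  have "cut_size {n + i<..2 * n + 2 * m - i} (rank_matching m n C) \<le> n" if "i \<in> {1..m - 1}" for i
  proof -
    have "line_intersections i C \<le> n" by (rule realizable_line_intersections[OF R]) (use that in auto)
    then show ?thesis using line_intersections_eq_cut[OF catalan_statesD(1)[OF C], of i] that by auto
  qed
  moreover have "cut_size {j<..2 * n + m - j} (rank_matching m n C) \<le> m" if "j \<in> {1..n - 1}" for j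
  proof -
    let ?C = "(`) transpose_point ` C"
    note T = transpose_realizable[OF R]
    have catT: "?C \<in> catalan_states n m" using T(1) unfolding realizable_states_def by blast
    have "line_intersections j ?C \<le> m" by (rule realizable_line_intersections[OF T(1)]) (use that in auto)
    then have "cut_size {m + j<..2 * m + 2 * n - j} (reflect (m + n) (rank_matching m n C)) \<le> m"
      using line_intersections_eq_cut[OF catalan_statesD(1)[OF catT], of j] that T(2) by auto
    moreover have "cut_size {m + j<..2 * m + 2 * n - j} (reflect (m + n) (rank_matching m n C)) =
        cut_size {2 * (m + n) - (2 * m + 2 * n - j)<..2 * (m + n) - (m + j)} (rank_matching m n C)"
      by (rule cut_reflect[OF rank_matching_perfect[OF catalan_statesD(1)[OF C]]]) (use that in auto)
    moreover have "2 * (m + n) - (2 * m + 2 * n - j) = j" "2 * (m + n) - (m + j) = 2 * n + m - j"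
      using that by auto
    ultimately show ?thesis by simp
  qed
  ultimately show "\<not> ?H \<and> \<not> ?V" by (meson not_le)
next
  assume "\<not> ?H \<and> \<not> ?V"
  then show ?R using realizable_if_line_conditions[OF C] by (meson not_le)
qed

lemma card_realizable_states:
  assumes mn: "1 \<le> m" "1 \<le> n"
  shows "card (realizable_states m n) + T_h m n + T_h n m = strip_walks (2 * (m + n)) (2 * (m + n)) 0"
proof -
  let ?N = "noncrossing_matchings {1..2 * (m + n)}"
  let ?H = "\<lambda>D. \<exists>i\<in>{1..m - 1}. n < cut_size {n + i<..2 * n + 2 * m - i} D"
  let ?V = "\<lambda>D. \<exists>j\<in>{1..n - 1}. m < cut_size {j<..2 * n + m - j} D"
  have "{C \<in> catalan_states m n. C \<in> realizable_states m n} = realizable_states m n"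
    unfolding realizable_states_def by blast
  moreover have "card {C \<in> catalan_states m n. C \<in> realizable_states m n} = card {D \<in> ?N. \<not> ?H D \<and> \<not> ?V D}"
    by (rule card_filter_bij[OF rank_matching_bij]) (rule realizable_iff)
  ultimately have R: "card (realizable_states m n) = card {D \<in> ?N. \<not> ?H D \<and> \<not> ?V D}"
    by (simp only:)
  have fin: "finite ?N" using finite_open_matchings[of "{1..2 * (m + n)}" 0]
    unfolding open_matchings_0[OF finite_atLeastAtMost] by simp
  have excl: "\<not> (?H D \<and> ?V D)" if "D \<in> ?N" for D
    using horizontal_vertical_exclusive[OF that] by blast
  have "?N = {D \<in> ?N. \<not> ?H D \<and> \<not> ?V D} \<union> {D \<in> ?N. ?H D} \<union> {D \<in> ?N. ?V D}" by blast
  moreover have "card ({D \<in> ?N. \<not> ?H D \<and> \<not> ?V D} \<union> {D \<in> ?N. ?H D} \<union> {D \<in> ?N. ?V D}) =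
      card ({D \<in> ?N. \<not> ?H D \<and> \<not> ?V D} \<union> {D \<in> ?N. ?H D}) + card {D \<in> ?N. ?V D}"
    by (rule card_Un_disjoint) (use fin excl in auto)
  moreover have "card ({D \<in> ?N. \<not> ?H D \<and> \<not> ?V D} \<union> {D \<in> ?N. ?H D}) =
      card {D \<in> ?N. \<not> ?H D \<and> \<not> ?V D} + card {D \<in> ?N. ?H D}"
    by (rule card_Un_disjoint) (use fin in auto)
  ultimately have "card ?N = card (realizable_states m n) + card {D \<in> ?N. ?H D} + card {D \<in> ?N. ?V D}"
    unfolding R by (simp only:)
  then show ?thesis
    unfolding T_h_eq[OF mn(1)] T_h_transposed_eq[OF mn(2)] card_noncrossing_matchings by simp
qed

lemma T_h_square:
  assumes "1 \<le> n"
  shows "int (T_h n n) = int (binom (4 * n) (int n - 2)) - 2 * int (binom (4 * n) (int n - 3))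
    + int (binom (4 * n) (int n - 4))"
proof -
  have N: "2 * (n + n) = 4 * n" by simp
  have "T_h n n + strip_walks (n + 1) (4 * n) 0 = strip_walks (4 * n) (4 * n) 0"
    using card_line_exceeds[of n n] unfolding T_h_eq[OF assms, of n, symmetric] unfolding N .
  then have "int (T_h n n) + int (strip_walks (n + 1) (4 * n) 0) = int (strip_walks (4 * n) (4 * n) 0)"
    by (simp only: of_nat_add[symmetric])
  moreover have "int (strip_walks (4 * n) (4 * n) 0) =
      int (binom (4 * n) (2 * int n)) - int (binom (4 * n) (2 * int n - 1))"
    using strip_walks_large[of "2 * n"] by (simp add: binom_def nat_mult_distrib)
  ultimately show ?thesis using strip_walks_square[of n] by simp
qed

theorem corollary4p7:
  fixes m n :: nat
  assumes "m \<ge> 1" and "n \<ge> 1"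
  shows "real (card (realizable_states m n)) =
           1 / real (m + n + 1) * real ((2 * (m + n)) choose (m + n))
             - real (T_h m n) - real (T_h n m)
       \<and> real (card (realizable_states n n)) =
           1 / real (2 * n + 1) * real ((4 * n) choose (2 * n))
             - 2 * (real (binom (4 * n) (int n - 2)) - 2 * real (binom (4 * n) (int n - 3))
                    + real (binom (4 * n) (int n - 4)))"
proof -
  have count: "real (card (realizable_states k n)) =
      1 / real (k + n + 1) * real ((2 * (k + n)) choose (k + n)) - real (T_h k n) - real (T_h n k)"
    if "1 \<le> k" for k
    using arg_cong[OF card_realizable_states[OF that assms(2)], of real] catalan_number[of "k + n"] by simp
  have T: "real (T_h n n) = real (binom (4 * n) (int n - 2)) - 2 * real (binom (4 * n) (int n - 3))
      + real (binom (4 * n) (int n - 4))"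
    using arg_cong[OF T_h_square[OF assms(2)], of real_of_int] by simp
  have "2 * (n + n) = 4 * n" "n + n = 2 * n" by simp_all
  with count[OF assms(2)] T have "real (card (realizable_states n n)) =
           1 / real (2 * n + 1) * real ((4 * n) choose (2 * n))
             - 2 * (real (binom (4 * n) (int n - 2)) - 2 * real (binom (4 * n) (int n - 3))
                    + real (binom (4 * n) (int n - 4)))"
    by (simp only:) simp
  with count[OF assms(1)] show ?thesis by blast
qed

end
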